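(* Let $f,g:\mathbb{Z}^+\to\mathbb{Z}^+$ be functions with $f(n)\ge g(n)$ for all $n$, $\lim_{n\to\infty}\frac{f(n)}{n}=0$, $\lim_{n\to\infty}f(n)=\infty$, and $\liminf_{n\to\infty}\frac{g(n)}{f(n)}>r>0$ for some real $r$. Let $M_n=M(\vec b_n(f,g))$, let $c$ be a real constant, and let $$t=\frac{(n+2\Delta)(\log g(n)+\log f(n))}{4f(n)}-c\,\frac{n+2\Delta}{4f(n)}$$ (rounded down if not an integer). Then the random transposition walk on $S_{M_n}$, started at any $x\in S_{M_n}$, satisfies $$\liminf_{n\to\infty}\left\|P^t(x,\cdot)-\pi\right\|_{TV}\ge \frac1e-e^{-re^c},$$ and thus the walk has not mixed by time $t$ for sufficiently large $c$.
   Context: For an $n\times n$ $\{0,1\}$-matrix $M$ let $S_M=\{\sigma\in S_n : M(i,\sigma(i))=1 \text{ for all } i\}$. For $\vec b=(b_1,\dots,b_n)$ with entries in $\{1,\dots,n\}$, $M(\vec b)$ is the matrix with $M(\vec b)(i,j)=1$ iff $j\ge b_i$. The vector $\vec b_n(f,g)=(b_1,\dots,b_n)$ has $b_i=1$ for $i\le f(n)$ and $b_i=g(n)+1$ for $f(n)<i\le n$. Thus $S_{M_n}=\{\sigma\in S_n:\sigma(i)\ge g(n)+1\text{ for all } i>f(n)\}$ (only $n$ with $f(n)<n$ matter, which holds for all large $n$). Random transposition walk on $S_M$: from $\sigma$, choose an ordered pair $(i,j)\in\{1,\dots,n\}^2$ ($i=j$ allowed) uniformly among those pairs for which the permutation obtained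 from $\sigma$ by exchanging the values in positions $i$ and $j$ is in $S_M$, and move to that permutation. The induced graph on $S_{M_n}$ (joining permutations differing by one such exchange with $i\neq j$) is regular of degree $\Delta=\sum_{i=1}^n(i-b_i)$, and $n+2\Delta=n^2-2ng(n)+2f(n)g(n)$. Hence $P(\sigma,\sigma)=\frac{n}{n+2\Delta}$, $P(\sigma,\tau)=\frac{2}{n+2\Delta}$ for adjacent $\sigma,\tau$, and the stationary distribution $\pi$ is uniform. Total variation distance is $\|\mu-\nu\|_{TV}=\frac12\sum_x|\mu(x)-\nu(x)|$. *)

theory Defs
  imports "HOL-Probability.Probability" "HOL-Combinatorics.Combinatorics"
begin

text \<open>
  An \<open>n \<times> n\<close> matrix with entries in \<open>{0,1}\<close> is a function \<open>nat \<Rightarrow> nat \<Rightarrow> nat\<close> of which only the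
  values at row and column indices in \<open>{1..n}\<close> are used. Permutations of \<open>{1..n}\<close> are functions on
  \<open>nat\<close> that are the identity outside \<open>{1..n}\<close>.
\<close>

definition restricted_perms :: "nat \<Rightarrow> (nat \<Rightarrow> nat \<Rightarrow> nat) \<Rightarrow> (nat \<Rightarrow> nat) set" where
  "restricted_perms n M = {\<sigma>. \<sigma> permutes {1..n} \<and> (\<forall>i\<in>{1..n}. M i (\<sigma> i) = 1)}"

definition mat_of_bounds :: "(nat \<Rightarrow> nat) \<Rightarrow> nat \<Rightarrow> nat \<Rightarrow> nat" where
  "mat_of_bounds b = (\<lambda>i j. if b i \<le> j then 1 else 0)"

definition bounds_fg :: "(nat \<Rightarrow> nat) \<Rightarrow> (nat \<Rightarrow> nat) \<Rightarrow> nat \<Rightarrow> nat \<Rightarrow> nat" where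
  "bounds_fg f g n = (\<lambda>i. if i \<le> f n then 1 else g n + 1)"

text \<open>
  Precomposing \<open>\<sigma>\<close> with \<open>Transposition.transpose i j\<close> exchanges the values in positions \<open>i\<close> and \<open>j\<close>. For
  \<open>n \<ge> 1\<close> and \<open>\<sigma>\<close> in the state space the set of admissible pairs is nonempty, as it contains all
  pairs \<open>(i, i)\<close>.
\<close>

definition transposition_step ::
    "nat \<Rightarrow> (nat \<Rightarrow> nat \<Rightarrow> nat) \<Rightarrow> (nat \<Rightarrow> nat) \<Rightarrow> (nat \<Rightarrow> nat) pmf" where
  "transposition_step n M \<sigma> =
     map_pmf (\<lambda>(i, j). \<sigma> \<circ> Transposition.transpose i j)
       (pmf_of_set {(i, j) \<in> {1..n} \<times> {1..n}. \<sigma> \<circ> Transposition.transpose i j \<in> restricted_perms n M})"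

primrec transposition_walk ::
    "nat \<Rightarrow> (nat \<Rightarrow> nat \<Rightarrow> nat) \<Rightarrow> nat \<Rightarrow> (nat \<Rightarrow> nat) \<Rightarrow> (nat \<Rightarrow> nat) pmf" where
  "transposition_walk n M 0 x = return_pmf x"
| "transposition_walk n M (Suc t) x =
     bind_pmf (transposition_walk n M t x) (transposition_step n M)"

definition stationary_dist :: "nat \<Rightarrow> (nat \<Rightarrow> nat \<Rightarrow> nat) \<Rightarrow> (nat \<Rightarrow> nat) pmf" where
  "stationary_dist n M = pmf_of_set (restricted_perms n M)"

definition tv_dist :: "'a pmf \<Rightarrow> 'a pmf \<Rightarrow> real" where
  "tv_dist \<mu> \<nu> = 1 / 2 * (\<Sum>\<^sub>\<infinity>x. \<bar>pmf \<mu> x - pmf \<nu> x\<bar>)"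

definition graph_degree :: "nat \<Rightarrow> (nat \<Rightarrow> nat) \<Rightarrow> real" where
  "graph_degree n b = (\<Sum>i=1..n. real i - real (b i))"

text \<open>
  The conversion \<open>nat\<close> truncates a negative value to \<open>0\<close>; this concerns only finitely many \<open>n\<close> if
  \<open>f n\<close> tends to infinity, \<open>f n / n\<close> to zero, and \<open>g \<ge> 1\<close>.
\<close>

definition walk_time :: "(nat \<Rightarrow> nat) \<Rightarrow> (nat \<Rightarrow> nat) \<Rightarrow> real \<Rightarrow> nat \<Rightarrow> nat" where
  "walk_time f g c n =
     (let N = real n + 2 * graph_degree n (bounds_fg f g n)
      in nat \<lfloor>N * (ln (real (g n)) + ln (real (f n))) / (4 * real (f n))
               - c * (N / (4 * real (f n)))\<rfloor>)"

definition tv_at_walk_time ::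
    "(nat \<Rightarrow> nat) \<Rightarrow> (nat \<Rightarrow> nat) \<Rightarrow> real \<Rightarrow> nat \<Rightarrow> (nat \<Rightarrow> nat) \<Rightarrow> real" where
  "tv_at_walk_time f g c n x =
     (let M = mat_of_bounds (bounds_fg f g n)
      in tv_dist (transposition_walk n M (walk_time f g c n) x) (stationary_dist n M))"

end

theory Submission
  imports Defs "HOL-Real_Asymp.Real_Asymp"
begin

text \<open>
  Write \<open>N = n + 2 \<Delta>\<close> for the number of admissible ordered pairs and call the values \<open>1, \<dots>, g\<close> small.
  They can only occupy the first \<open>f\<close> positions, so an exchange moves a given small value with
  probability about \<open>2 f / N\<close>. This is slow, and it is what keeps the walk from mixing. Let \<open>X\<close>
  be the number of small values that sit where the starting permutation \<open>x\<close> puts them, and let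
  \<open>\<rho> = g / f \<le> 1\<close>. Under the uniform distribution \<open>X\<close> is roughly Poisson with mean \<open>\<rho>\<close>. At the time in
  question each small value is still unmoved with probability about
  \<open>(1 - 2 f / N) ^ t \<approx> exp (c / 2) / sqrt (g f)\<close>. Hence a further \<open>\<mu>\<close> agreements are expected, where
  \<open>\<mu> \<approx> sqrt \<rho> * exp (c / 2)\<close>, which is eventually larger than \<open>sqrt (r * exp c)\<close>.

  Comparing the events \<open>X = 0\<close> is not enough: for Poisson variables with means \<open>1\<close> and \<open>1 + \<mu>\<close> it
  yields \<open>(1 - exp (- \<mu>)) / e\<close>, which drops below the required \<open>1 / e - exp (- \<mu>\<^sup>2)\<close> for large \<open>\<mu>\<close>. The
  test function used instead is \<open>2 ^ (- X)\<close>, a value of the generating function \<open>E (1 - a) ^ X\<close>. As it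
  takes values in \<open>[0, 1]\<close>, the total variation distance is at least the difference of its two
  expectations.

  For the walk, one step turns \<open>E (1 - a) ^ X\<close> into about \<open>(1 - k) E (1 - q a) ^ X\<close>, with
  \<open>q = 1 - 2 f / N\<close>: agreements are destroyed at rate \<open>2 f / N\<close> each and created at total rate at
  most \<open>2 g / N\<close> (\<open>expectation_step_le\<close>). The errors sum to \<open>6 t / N\<close>, which vanishes. Iteration
  (\<open>expectation_walk_le\<close>) gives at most about \<open>exp (- 5 \<rho> / 12 - \<mu> / 2)\<close>. The exact limit has
  \<open>\<rho> / 2\<close> in place of \<open>5 \<rho> / 12\<close>. The loss comes from exchanges that create two agreements at once; bounding
  their number trivially avoids any study of the joint motion of two values.

  For the uniform distribution, invariance under the admissible exchanges is a differential inequality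
  in \<open>s\<close> for \<open>E s ^ X\<close>, and integrating it from \<open>1\<close> gives \<open>E 2 ^ (- X) \<ge> exp (- g / (2 (f - 1)))\<close>
  (\<open>expectation_stationary_ge\<close>).

  The difference is smallest at \<open>\<rho> = 1\<close>, so in the limit the distance is at least
  \<open>exp (- 1 / 2) - exp (- 5 / 12 - \<mu> / 2)\<close> for \<open>\<mu> = sqrt (r * exp c)\<close>. If \<open>\<mu> \<le> 1\<close> the claim is trivial,
  because the bound is not positive; otherwise \<open>exp_gap_inequality\<close> shows that this exceeds
  \<open>1 / e - exp (- \<mu>\<^sup>2)\<close>. The resulting estimate holds for all large \<open>n\<close> and is uniform in the starting
  state, so it yields both the bound on the limit inferior and the statement on large \<open>c\<close>.
\<close>

section \<open>Restricted permutations and admissible exchanges\<close>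

locale two_block_walk =
  fixes n f g :: nat
  assumes g_le_f: "g \<le> f" and f_less_n: "f < n"
begin

definition M :: "nat \<Rightarrow> nat \<Rightarrow> nat" where
  "M = mat_of_bounds (\<lambda>i. if i \<le> f then 1 else g + 1)"

definition S :: "(nat \<Rightarrow> nat) set" where
  "S = restricted_perms n M"

definition small :: "(nat \<Rightarrow> nat) \<Rightarrow> nat set" where
  "small \<sigma> = {p \<in> {1..n}. \<sigma> p \<le> g}"

text \<open>The number of admissible ordered pairs, which is the same in every state (\<open>card_swaps\<close>) and
  equals \<open>n + 2 \<Delta>\<close> (\<open>N_eq_graph_degree\<close>).\<close>
definition N :: real where
  "N = real n ^ 2 - 2 * real g * (real n - real f)"

definition swaps :: "(nat \<Rightarrow> nat) \<Rightarrow> (nat \<times> nat) set" where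
  "swaps \<sigma> = {(i, j) \<in> {1..n} \<times> {1..n}. \<sigma> \<circ> Transposition.transpose i j \<in> S}"

text \<open>In the applications \<open>x\<close> is the starting state, and the walk is observed only through the size of
  this set.\<close>
definition agree :: "(nat \<Rightarrow> nat) \<Rightarrow> (nat \<Rightarrow> nat) \<Rightarrow> nat set" where
  "agree x \<sigma> = {p \<in> small x. \<sigma> p = x p}"

lemma S_iff: "\<sigma> \<in> S \<longleftrightarrow> \<sigma> permutes {1..n} \<and> (\<forall>p\<in>{1..n}. f < p \<longrightarrow> g < \<sigma> p)"
proof -
  have "M i (\<sigma> i) = 1 \<longleftrightarrow> (f < i \<longrightarrow> g < \<sigma> i)" if "\<sigma> permutes {1..n}" "i \<in> {1..n}" for i
  proof -
    have "1 \<le> \<sigma> i" using permutes_in_image[OF that(1)] that(2) by auto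
    then show ?thesis by (auto simp: M_def mat_of_bounds_def)
  qed
  then show ?thesis unfolding S_def restricted_perms_def by auto
qed

lemma finite_S: "finite S"
  by (rule finite_subset[OF _ finite_permutations[of "{1..n}"]]) (auto simp: S_iff)

lemma finite_small [simp]: "finite (small \<sigma>)"
  by (simp add: small_def)

lemma small_subset: "\<sigma> \<in> S \<Longrightarrow> small \<sigma> \<subseteq> {1..f}"
  unfolding S_iff small_def by (force simp: not_less)

lemma card_small: assumes "\<sigma> \<in> S" shows "card (small \<sigma>) = g"
proof -
  have p: "\<sigma> permutes {1..n}" using assms by (simp add: S_iff)
  have "\<sigma> ` small \<sigma> = {1..g}"
  proof (intro equalityI subsetI)
    fix v assume "v \<in> \<sigma> ` small \<sigma>"
    then show "v \<in> {1..g}" using permutes_in_image[OF p] by (force simp: small_def)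
  next
    fix v assume v: "v \<in> {1..g}"
    have "inv \<sigma> v \<in> {1..n}"
      using v g_le_f f_less_n permutes_in_image[OF permutes_inv[OF p], of v] by auto
    then show "v \<in> \<sigma> ` small \<sigma>"
      using v permutes_inverses(1)[OF p, of v] by (force simp: small_def)
  qed
  moreover have "inj_on \<sigma> (small \<sigma>)" using permutes_inj_on[OF p] .
  ultimately show ?thesis using card_image[of \<sigma> "small \<sigma>"] by simp
qed

text \<open>An exchange is forbidden only if it carries a small value beyond position \<open>f\<close>.\<close>
lemma swap_in_S_iff:
  assumes "\<sigma> \<in> S" and ij: "i \<in> {1..n}" "j \<in> {1..n}"
  shows "\<sigma> \<circ> Transposition.transpose i j \<in> S \<longleftrightarrow>
    \<not> (i \<in> small \<sigma> \<and> f < j) \<and> \<not> (f < i \<and> j \<in> small \<sigma>)" (is "?L = ?R")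
proof -
  have p: "\<sigma> permutes {1..n}" and h: "\<And>p. p \<in> {1..n} \<Longrightarrow> f < p \<Longrightarrow> g < \<sigma> p"
    using assms by (auto simp: S_iff)
  have "\<sigma> \<circ> Transposition.transpose i j permutes {1..n}"
    using permutes_compose[OF permutes_swap_id[OF ij] p] .
  then have "?L \<longleftrightarrow> (\<forall>p\<in>{1..n}. f < p \<longrightarrow> g < \<sigma> (Transposition.transpose i j p))"
    by (simp add: S_iff)
  also have "\<dots> \<longleftrightarrow> ?R"
  proof
    assume a: "\<forall>p\<in>{1..n}. f < p \<longrightarrow> g < \<sigma> (Transposition.transpose i j p)"
    show ?R using a[rule_format, OF ij(1)] a[rule_format, OF ij(2)] by (auto simp: small_def)
  next
    assume ?R
    then show "\<forall>p\<in>{1..n}. f < p \<longrightarrow> g < \<sigma> (Transposition.transpose i j p)"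
      using ij h by (auto simp: Transposition.transpose_def small_def not_le)
  qed
  finally show ?thesis .
qed

lemma card_swaps: assumes "\<sigma> \<in> S" shows "real (card (swaps \<sigma>)) = N"
proof -
  let ?B = "small \<sigma> \<times> {f<..n} \<union> {f<..n} \<times> small \<sigma>"
  have sub: "small \<sigma> \<subseteq> {1..f}" using small_subset[OF assms] .
  have eq: "swaps \<sigma> = {1..n} \<times> {1..n} - ?B"
    unfolding swaps_def using swap_in_S_iff[OF assms] by auto
  have "card ?B = 2 * (g * (n - f))"
    by (subst card_Un_disjoint) (use sub in \<open>auto simp: card_cartesian_product card_small[OF assms]\<close>)
  moreover have "?B \<subseteq> {1..n} \<times> {1..n}" using sub f_less_n by auto
  ultimately have "card (swaps \<sigma>) = n * n - 2 * (g * (n - f))"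
    unfolding eq by (subst card_Diff_subset) (auto simp: card_cartesian_product)
  moreover have "2 * (g * (n - f)) \<le> n * n"
  proof -
    have "2 * (real g * (real n - real f)) \<le> 2 * (real f * (real n - real f))"
      using g_le_f f_less_n by (intro mult_left_mono mult_right_mono) auto
    also have "\<dots> \<le> real n * real n"
      using sum_squares_ge_zero[of "real f" "real n - real f"] by (simp add: algebra_simps)
    finally have "real (2 * (g * (n - f))) \<le> real (n * n)" using f_less_n by (simp add: of_nat_diff)
    then show ?thesis by linarith
  qed
  ultimately show ?thesis
    using f_less_n by (simp add: N_def of_nat_diff power2_eq_square algebra_simps)
qed

lemma N_pos: "N > 0"
proof -
  have "real g * (real n - real f) \<le> real f * (real n - real f)"
    using g_le_f f_less_n by (intro mult_right_mono) auto
  then have "N \<ge> real f ^ 2 + (real n - real f) ^ 2"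
    by (simp add: N_def power2_eq_square algebra_simps)
  moreover have "(real n - real f) ^ 2 > 0" using f_less_n by simp
  ultimately show ?thesis by (smt (verit) zero_le_power2)
qed

lemma finite_swaps [simp]: "finite (swaps \<sigma>)"
  by (rule finite_subset[of _ "{1..n} \<times> {1..n}"]) (auto simp: swaps_def)

lemma expectation_step:
  fixes \<phi> :: "(nat \<Rightarrow> nat) \<Rightarrow> real"
  assumes "\<sigma> \<in> S"
  shows "measure_pmf.expectation (transposition_step n M \<sigma>) \<phi> =
    (\<Sum>(i, j)\<in>swaps \<sigma>. \<phi> (\<sigma> \<circ> Transposition.transpose i j)) / N"
proof -
  have "swaps \<sigma> \<noteq> {}" using card_swaps[OF assms] N_pos by force
  then show ?thesis
    unfolding transposition_step_def S_def[symmetric] swaps_def[symmetric]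
    by (simp add: integral_pmf_of_set card_swaps[OF assms] case_prod_unfold)
qed

lemma set_step: assumes "\<sigma> \<in> S" shows "set_pmf (transposition_step n M \<sigma>) \<subseteq> S"
proof -
  have "swaps \<sigma> \<noteq> {}" using card_swaps[OF assms] N_pos by force
  then show ?thesis
    unfolding transposition_step_def S_def[symmetric] swaps_def[symmetric]
    by (auto simp: set_pmf_of_set) (simp add: swaps_def)
qed

lemma set_walk: assumes "x \<in> S" shows "set_pmf (transposition_walk n M t x) \<subseteq> S"
  by (induction t) (use assms set_step in auto)

text \<open>The last step is split off, so the expected value after one step is a new test function
  for the shorter walk.\<close>
lemma expectation_walk_Suc:
  fixes \<phi> :: "(nat \<Rightarrow> nat) \<Rightarrow> real"
  assumes "x \<in> S"
  shows "measure_pmf.expectation (transposition_walk n M (Suc t) x) \<phi> =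
    measure_pmf.expectation (transposition_walk n M t x)
      (\<lambda>\<sigma>. measure_pmf.expectation (transposition_step n M \<sigma>) \<phi>)"
proof -
  have "measure_pmf.expectation (transposition_walk n M (Suc t) x) \<phi> =
    (\<Sum>\<sigma>\<in>S. pmf (transposition_walk n M t x) \<sigma> * measure_pmf.expectation (transposition_step n M \<sigma>) \<phi>)"
    unfolding transposition_walk.simps
    by (subst pmf_expectation_bind[of S])
      (use finite_S set_walk[OF assms] in \<open>auto intro: finite_subset[OF set_step]\<close>)
  also have "\<dots> = measure_pmf.expectation (transposition_walk n M t x)
      (\<lambda>\<sigma>. measure_pmf.expectation (transposition_step n M \<sigma>) \<phi>)"
    by (subst integral_measure_pmf[of S]) (use finite_S set_walk[OF assms] in auto)
  finally show ?thesis .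
qed

end

section \<open>Agreements gained and lost in one exchange\<close>

text \<open>Both one-step estimates sum a pointwise bound that is linear in indicators of losing and of
  gaining an agreement at one of the two positions.\<close>
lemma sum_linear_combination:
  fixes A A' B C C' :: "'a \<Rightarrow> real"
  shows "(\<Sum>z\<in>T. P + P * (\<beta> * (A z + A' z) + \<gamma> * B z - \<delta> * (C z + C' z))) =
    P * (real (card T) + \<beta> * (sum A T + sum A' T) + \<gamma> * sum B T - \<delta> * (sum C T + sum C' T))"
  by (simp add: sum.distrib sum_subtractf sum_distrib_left[symmetric] distrib_left right_diff_distrib)

context two_block_walk
begin

lemma swaps_commute: "(j, i) \<in> swaps \<sigma> \<longleftrightarrow> (i, j) \<in> swaps \<sigma>"
  by (auto simp: swaps_def transpose_commute)

lemma agree_subset: "agree x \<sigma> \<subseteq> small x" "x \<in> S \<Longrightarrow> agree x \<sigma> \<subseteq> {1..f}"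
  using small_subset[of x] by (auto simp: agree_def)

lemma finite_agree [simp]: "finite (agree x \<sigma>)"
  by (rule finite_subset[OF agree_subset(1)]) simp

text \<open>An agreeing position carries a small value, so it can be exchanged with exactly the first \<open>f\<close>
  positions.\<close>
lemma swap_agree_iff:
  assumes "\<sigma> \<in> S" "x \<in> S" "i \<in> agree x \<sigma>"
  shows "(i, j) \<in> swaps \<sigma> \<longleftrightarrow> j \<in> {1..f}"
proof -
  have i: "i \<in> small \<sigma>" "i \<in> {1..n}" "i \<le> f"
    using assms(3) agree_subset(2)[OF assms(2), of \<sigma>] by (auto simp: agree_def small_def)
  have "(i, j) \<in> swaps \<sigma> \<longleftrightarrow> j \<in> {1..n} \<and> \<not> f < j"
    using swap_in_S_iff[OF assms(1) i(2), of j] i by (auto simp: swaps_def)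
  then show ?thesis using f_less_n by auto
qed

lemma sum_agree_swaps:
  assumes "\<sigma> \<in> S" "x \<in> S"
  shows "(\<Sum>(i, j)\<in>swaps \<sigma>. of_bool (i \<noteq> j \<and> i \<in> agree x \<sigma>)) =
    real (card (agree x \<sigma>)) * (real f - 1)"
proof -
  have sub: "agree x \<sigma> \<subseteq> small \<sigma>" "agree x \<sigma> \<subseteq> {1..f}" "small \<sigma> \<subseteq> {1..f}"
    using agree_subset(2)[OF assms(2)] small_subset[OF assms(1)] by (auto simp: agree_def small_def)
  have eq: "swaps \<sigma> \<inter> {z. fst z \<noteq> snd z \<and> fst z \<in> agree x \<sigma>} = (SIGMA i:agree x \<sigma>. {1..f} - {i})"
    using swap_agree_iff[OF assms] by auto
  have "(\<Sum>(i, j)\<in>swaps \<sigma>. of_bool (i \<noteq> j \<and> i \<in> agree x \<sigma>)) =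
     real (card (SIGMA i:agree x \<sigma>. {1..f} - {i}))"
    unfolding eq[symmetric] case_prod_unfold by (rule sum_of_bool_eq) simp_all
  also have "card (SIGMA i:agree x \<sigma>. {1..f} - {i}) = (\<Sum>i\<in>agree x \<sigma>. card ({1..f} - {i}))"
    by (rule card_SigmaI) simp_all
  also have "\<dots> = (\<Sum>i\<in>agree x \<sigma>. f - 1)"
    by (rule sum.cong) (use sub(2) in auto)
  also have "real \<dots> = real (card (agree x \<sigma>)) * (real f - 1)"
    using sub(2) by (cases "f = 0") (auto simp: of_nat_diff)
  finally show ?thesis .
qed

lemma sum_agree_both_swaps:
  assumes "\<sigma> \<in> S" "x \<in> S"
  shows "(\<Sum>(i, j)\<in>swaps \<sigma>. of_bool (i \<noteq> j \<and> i \<in> agree x \<sigma> \<and> j \<in> agree x \<sigma>)) =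
    real (card (agree x \<sigma>)) * (real (card (agree x \<sigma>)) - 1)"
proof -
  let ?F = "agree x \<sigma>"
  have sub: "?F \<subseteq> small \<sigma>" "?F \<subseteq> {1..f}" "small \<sigma> \<subseteq> {1..f}"
    using agree_subset(2)[OF assms(2)] small_subset[OF assms(1)] by (auto simp: agree_def small_def)
  have eq: "swaps \<sigma> \<inter> {z. fst z \<noteq> snd z \<and> fst z \<in> ?F \<and> snd z \<in> ?F} = (SIGMA i:?F. ?F - {i})"
    using swap_agree_iff[OF assms] sub by auto
  have "(\<Sum>(i, j)\<in>swaps \<sigma>. of_bool (i \<noteq> j \<and> i \<in> ?F \<and> j \<in> ?F)) = real (card (SIGMA i:?F. ?F - {i}))"
    unfolding eq[symmetric] case_prod_unfold by (rule sum_of_bool_eq) simp_all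
  also have "card (SIGMA i:?F. ?F - {i}) = (\<Sum>i\<in>?F. card ?F - 1)"
    by (subst card_SigmaI) (auto intro!: sum.cong)
  also have "real \<dots> = real (card ?F) * (real (card ?F) - 1)"
    by (cases "card ?F") (auto simp: algebra_simps)
  finally show ?thesis .
qed

text \<open>A non-agreeing position \<open>i\<close> can be repaired by exactly one partner, the position where \<open>\<sigma>\<close> has
  the value \<open>x i\<close>; that value is small, so both positions are at most \<open>f\<close> and the exchange is
  admissible.\<close>
lemma sum_gain_swaps:
  assumes "\<sigma> \<in> S" "x \<in> S"
  shows "(\<Sum>(i, j)\<in>swaps \<sigma>. of_bool (i \<noteq> j \<and> i \<in> small x \<and> \<sigma> j = x i)) =
    real g - real (card (agree x \<sigma>))"
proof -
  let ?F = "agree x \<sigma>"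
  have p: "\<sigma> permutes {1..n}" "x permutes {1..n}" using assms by (auto simp: S_iff)
  have "swaps \<sigma> \<inter> {z. fst z \<noteq> snd z \<and> fst z \<in> small x \<and> \<sigma> (snd z) = x (fst z)} =
     (\<lambda>i. (i, inv \<sigma> (x i))) ` (small x - ?F)" (is "?A = ?B")
  proof (intro equalityI subsetI)
    fix z assume z: "z \<in> ?A"
    then have "inv \<sigma> (x (fst z)) = snd z"
      using permutes_inverses(2)[OF p(1), of "snd z"] by auto
    moreover have "fst z \<notin> ?F"
      using z inj_eq[OF permutes_inj[OF p(1)], of "fst z" "snd z"] by (auto simp: agree_def)
    ultimately show "z \<in> ?B" using z by (intro image_eqI[of _ _ "fst z"]) auto
  next
    fix z assume "z \<in> ?B"
    then obtain i where i: "i \<in> small x" "\<sigma> i \<noteq> x i" and z: "z = (i, inv \<sigma> (x i))"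
      by (auto simp: agree_def)
    define j where "j = inv \<sigma> (x i)"
    have j: "\<sigma> j = x i" using permutes_inverses(1)[OF p(1)] by (simp add: j_def)
    have i': "i \<in> {1..n}" "x i \<le> g" using i by (auto simp: small_def)
    have "j \<in> {1..n}"
      using permutes_in_image[OF p(1), of j] permutes_in_image[OF p(2), of i] unfolding j using i'(1) by blast
    then have js: "j \<in> small \<sigma>" using j i' by (simp add: small_def)
    have "i \<le> f" "j \<le> f" using small_subset[OF assms(1)] small_subset[OF assms(2)] i(1) js by auto
    then have "(i, j) \<in> swaps \<sigma>"
      using i' \<open>j \<in> {1..n}\<close> swap_in_S_iff[OF assms(1)] by (simp add: swaps_def)
    then show "z \<in> ?A" using i j by (auto simp: z j_def[symmetric])
  qed
  then have eq: "card ?A = card (small x - ?F)"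
    by (simp add: card_image inj_on_def)
  have "(\<Sum>(i, j)\<in>swaps \<sigma>. of_bool (i \<noteq> j \<and> i \<in> small x \<and> \<sigma> j = x i)) = real (card ?A)"
    unfolding case_prod_unfold by (rule sum_of_bool_eq) simp_all
  also have "\<dots> = real g - real (card ?F)"
    unfolding eq using agree_subset(1)[of x \<sigma>] card_mono[OF _ agree_subset(1)[of x \<sigma>]]
    by (simp add: card_Diff_subset card_small[OF assms(2)] of_nat_diff)
  finally show ?thesis .
qed

lemma sum_swaps_flip:
  "(\<Sum>(i, j)\<in>swaps \<sigma>. h j i) = (\<Sum>(i, j)\<in>swaps \<sigma>. h i j :: real)"
  by (rule sum.reindex_bij_witness[of _ prod.swap prod.swap]) (auto simp: swaps_commute)

lemma card_agree_swap:
  assumes "\<sigma> \<in> S" "x \<in> S" "i \<in> {1..n}" "j \<in> {1..n}" "i \<noteq> j"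
  defines "\<sigma>' \<equiv> \<sigma> \<circ> Transposition.transpose i j"
  shows "card (agree x \<sigma>') + of_bool (i \<in> agree x \<sigma>) + of_bool (j \<in> agree x \<sigma>) =
    card (agree x \<sigma>) + of_bool (i \<in> small x \<and> \<sigma> j = x i) + of_bool (j \<in> small x \<and> \<sigma> i = x j)"
proof -
  have card: "card (agree x \<tau>) = card (agree x \<tau> - {i, j}) + of_bool (i \<in> agree x \<tau>) + of_bool (j \<in> agree x \<tau>)" for \<tau>
  proof -
    have "card (agree x \<tau>) = card (agree x \<tau> - {i, j}) + card (agree x \<tau> \<inter> {i, j})"
      by (subst card_Un_disjoint[symmetric]) (auto intro!: arg_cong[where f = card])
    moreover have "card (agree x \<tau> \<inter> {i, j}) = of_bool (i \<in> agree x \<tau>) + of_bool (j \<in> agree x \<tau>)"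
      using \<open>i \<noteq> j\<close> by (auto simp: Int_insert_right)
    ultimately show ?thesis by simp
  qed
  have "agree x \<sigma>' - {i, j} = agree x \<sigma> - {i, j}"
    by (auto simp: agree_def \<sigma>'_def Transposition.transpose_def)
  moreover have "i \<in> agree x \<sigma>' \<longleftrightarrow> i \<in> small x \<and> \<sigma> j = x i" "j \<in> agree x \<sigma>' \<longleftrightarrow> j \<in> small x \<and> \<sigma> i = x j"
    by (auto simp: agree_def \<sigma>'_def)
  ultimately show ?thesis using card[of \<sigma>] card[of \<sigma>'] by simp
qed

abbreviation matches :: "(nat \<Rightarrow> nat) \<Rightarrow> (nat \<Rightarrow> nat) \<Rightarrow> nat" where
  "matches x \<sigma> \<equiv> card (agree x \<sigma>)"

text \<open>No exchange both destroys and creates agreements: if position \<open>i\<close> agrees, then \<open>x i\<close> moves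
  to \<open>j\<close>, where \<open>x j\<close> is wanted, and \<open>i\<close> receives a value other than \<open>x i\<close>.\<close>
lemma matches_swap_cases:
  assumes "\<sigma> \<in> S" "x \<in> S" "i \<in> {1..n}" "j \<in> {1..n}" "i \<noteq> j"
  defines "\<sigma>' \<equiv> \<sigma> \<circ> Transposition.transpose i j"
  obtains
    (lose) "\<not> (i \<in> small x \<and> \<sigma> j = x i)" "\<not> (j \<in> small x \<and> \<sigma> i = x j)"
      "matches x \<sigma> = matches x \<sigma>' + of_bool (i \<in> agree x \<sigma>) + of_bool (j \<in> agree x \<sigma>)"
  | (gain) "i \<notin> agree x \<sigma>" "j \<notin> agree x \<sigma>"
      "matches x \<sigma>' = matches x \<sigma> + of_bool (i \<in> small x \<and> \<sigma> j = x i) + of_bool (j \<in> small x \<and> \<sigma> i = x j)"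
proof (cases "i \<in> agree x \<sigma> \<or> j \<in> agree x \<sigma>")
  case True
  have inj: "\<sigma> i \<noteq> \<sigma> j" "x i \<noteq> x j"
    using assms permutes_inj[of \<sigma> "{1..n}"] permutes_inj[of x "{1..n}"] by (auto simp: S_iff dest: injD)
  then have 1: "\<not> (i \<in> small x \<and> \<sigma> j = x i)" "\<not> (j \<in> small x \<and> \<sigma> i = x j)"
    using True by (auto simp: agree_def)
  show ?thesis
    using card_agree_swap[OF assms(1-5)] 1 by (intro lose) (auto simp: \<sigma>'_def)
next
  case False
  then show ?thesis
    using card_agree_swap[OF assms(1-5)] by (intro gain) (auto simp: \<sigma>'_def)
qed

text \<open>The loss part is exact. In the gain part, \<open>m\<close> new agreements change the factor \<open>1\<close> to \<open>s ^ m\<close>,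
  and \<open>s ^ m - 1 \<le> - (1 - s) * (1 + s) / 2 * m\<close> holds for \<open>m \<le> 2\<close> with equality at \<open>m = 2\<close>. As it
  is linear in \<open>m\<close>, its sum over all exchanges depends only on the total number of agreements gained.\<close>
lemma pow_matches_swap_le:
  fixes s :: real
  assumes "\<sigma> \<in> S" "x \<in> S" "(i, j) \<in> swaps \<sigma>" "0 < s" "s \<le> 1"
  shows "s ^ matches x (\<sigma> \<circ> Transposition.transpose i j) \<le> s ^ matches x \<sigma> +
    s ^ matches x \<sigma> *
      ((1 / s - 1) * (of_bool (i \<noteq> j \<and> i \<in> agree x \<sigma>) + of_bool (j \<noteq> i \<and> j \<in> agree x \<sigma>))
       + (1 / s - 1)\<^sup>2 * of_bool (i \<noteq> j \<and> i \<in> agree x \<sigma> \<and> j \<in> agree x \<sigma>)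
       - (1 - s) * (1 + s) / 2 *
          (of_bool (i \<noteq> j \<and> i \<in> small x \<and> \<sigma> j = x i) + of_bool (j \<noteq> i \<and> j \<in> small x \<and> \<sigma> i = x j)))"
proof (cases "i = j")
  case False
  have ij: "i \<in> {1..n}" "j \<in> {1..n}" using assms(3) by (auto simp: swaps_def)
  have s1: "s \<le> 1 - (1 - s) * (1 + s) / 2" using zero_le_power2[of "1 - s"] by (simp add: power2_eq_square field_simps)
  have "s ^ m * s \<le> s ^ m * (1 - (1 - s) * (1 + s) / 2)" for m
    using s1 assms(4) by (intro mult_left_mono) auto
  then have s1': "s * s ^ m \<le> s ^ m + s ^ m * (- ((1 - s) * (1 + s) / 2))" for m
    by (simp add: algebra_simps)
  from assms(1,2) ij False show ?thesis
  proof (cases rule: matches_swap_cases)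
    case lose
    then show ?thesis using False assms(4)
      by (auto simp: power_add field_simps power2_eq_square)
  next
    case gain
    then show ?thesis using False s1'[of "matches x \<sigma>"]
      by (auto simp: power_add power2_eq_square algebra_simps diff_divide_distrib add_divide_distrib)
  qed
qed simp

text \<open>Bernoulli's inequality, applied to \<open>s ^ m\<close> for gains and to \<open>(1 / s) ^ l\<close> for losses.\<close>
lemma pow_matches_swap_ge:
  fixes s :: real
  assumes "\<sigma> \<in> S" "x \<in> S" "(i, j) \<in> swaps \<sigma>" "0 < s" "s \<le> 1"
  shows "s ^ matches x (\<sigma> \<circ> Transposition.transpose i j) \<ge> s ^ matches x \<sigma> +
    s ^ matches x \<sigma> *
      ((1 / s - 1) * (of_bool (i \<noteq> j \<and> i \<in> agree x \<sigma>) + of_bool (j \<noteq> i \<and> j \<in> agree x \<sigma>))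
       - (1 - s) *
          (of_bool (i \<noteq> j \<and> i \<in> small x \<and> \<sigma> j = x i) + of_bool (j \<noteq> i \<and> j \<in> small x \<and> \<sigma> i = x j)))"
proof (cases "i = j")
  case False
  have ij: "i \<in> {1..n}" "j \<in> {1..n}" using assms(3) by (auto simp: swaps_def)
  have "s ^ m * (1 - s)\<^sup>2 \<ge> 0" for m using assms(4) by auto
  then have sq: "s ^ m * (s * 2) \<le> s ^ m + s ^ m * (s * s)" for m
    by (simp add: power2_eq_square algebra_simps)
  from assms(1,2) ij False show ?thesis
  proof (cases rule: matches_swap_cases)
    case lose
    then show ?thesis using False assms(4) sq[of "matches x (\<sigma> \<circ> Transposition.transpose i j)"]
      sq[of "Suc (matches x (\<sigma> \<circ> Transposition.transpose i j))"]
      by (auto simp: power_add field_simps power2_eq_square)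
  next
    case gain
    then show ?thesis using False sq[of "matches x \<sigma>"]
      by (auto simp: power_add power2_eq_square algebra_simps)
  qed
qed simp

lemma sum_pow_matches_swaps_le:
  fixes s :: real
  assumes "\<sigma> \<in> S" "x \<in> S" "0 < s" "s \<le> 1"
  defines "X \<equiv> matches x \<sigma>"
  shows "(\<Sum>(i, j)\<in>swaps \<sigma>. s ^ matches x (\<sigma> \<circ> Transposition.transpose i j)) \<le> s ^ X *
    (N + (1 / s - 1) * (2 * real X * (real f - 1)) + (1 / s - 1)\<^sup>2 * (real X * (real X - 1))
     - (1 - s) * (1 + s) * (real g - real X))"
proof -
  let ?a = "\<lambda>i j. of_bool (i \<noteq> j \<and> i \<in> agree x \<sigma>) :: real"
  let ?b = "\<lambda>i j. of_bool (i \<noteq> j \<and> i \<in> agree x \<sigma> \<and> j \<in> agree x \<sigma>) :: real"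
  let ?c = "\<lambda>i j. of_bool (i \<noteq> j \<and> i \<in> small x \<and> \<sigma> j = x i) :: real"
  have "(\<Sum>(i, j)\<in>swaps \<sigma>. s ^ matches x (\<sigma> \<circ> Transposition.transpose i j)) \<le>
    (\<Sum>(i, j)\<in>swaps \<sigma>. s ^ X + s ^ X * ((1 / s - 1) * (?a i j + ?a j i)
       + (1 / s - 1)\<^sup>2 * ?b i j - (1 - s) * (1 + s) / 2 * (?c i j + ?c j i)))"
    unfolding X_def by (rule sum_mono) (use pow_matches_swap_le[OF assms(1,2) _ assms(3,4)] in auto)
  also have "\<dots> = s ^ X * (real (card (swaps \<sigma>)) + (1 / s - 1) * ((\<Sum>(i, j)\<in>swaps \<sigma>. ?a i j) + (\<Sum>(i, j)\<in>swaps \<sigma>. ?a j i))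
       + (1 / s - 1)\<^sup>2 * (\<Sum>(i, j)\<in>swaps \<sigma>. ?b i j)
       - (1 - s) * (1 + s) / 2 * ((\<Sum>(i, j)\<in>swaps \<sigma>. ?c i j) + (\<Sum>(i, j)\<in>swaps \<sigma>. ?c j i)))"
    unfolding case_prod_unfold by (rule sum_linear_combination)
  also have "\<dots> = s ^ X * (N + (1 / s - 1) * (2 * real X * (real f - 1))
     + (1 / s - 1)\<^sup>2 * (real X * (real X - 1)) - (1 - s) * (1 + s) * (real g - real X))"
    unfolding sum_swaps_flip[of "?a"] sum_swaps_flip[of "?c"] sum_agree_swaps[OF assms(1,2)]
      sum_agree_both_swaps[OF assms(1,2)] sum_gain_swaps[OF assms(1,2)] card_swaps[OF assms(1)] X_def
    by (simp add: field_simps)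
  finally show ?thesis .
qed

lemma sum_pow_matches_swaps_ge:
  fixes s :: real
  assumes "\<sigma> \<in> S" "x \<in> S" "0 < s" "s \<le> 1"
  defines "X \<equiv> matches x \<sigma>"
  shows "(\<Sum>(i, j)\<in>swaps \<sigma>. s ^ matches x (\<sigma> \<circ> Transposition.transpose i j)) \<ge> s ^ X *
    (N + (1 / s - 1) * (2 * real X * (real f - 1)) - 2 * (1 - s) * (real g - real X))"
proof -
  let ?a = "\<lambda>i j. of_bool (i \<noteq> j \<and> i \<in> agree x \<sigma>) :: real"
  let ?c = "\<lambda>i j. of_bool (i \<noteq> j \<and> i \<in> small x \<and> \<sigma> j = x i) :: real"
  have "(\<Sum>(i, j)\<in>swaps \<sigma>. s ^ matches x (\<sigma> \<circ> Transposition.transpose i j)) \<ge>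
    (\<Sum>(i, j)\<in>swaps \<sigma>. s ^ X + s ^ X * ((1 / s - 1) * (?a i j + ?a j i) - (1 - s) * (?c i j + ?c j i)))"
    unfolding X_def by (rule sum_mono) (use pow_matches_swap_ge[OF assms(1,2) _ assms(3,4)] in auto)
  moreover have "(\<Sum>(i, j)\<in>swaps \<sigma>. s ^ X + s ^ X * ((1 / s - 1) * (?a i j + ?a j i) - (1 - s) * (?c i j + ?c j i)))
    = s ^ X * (real (card (swaps \<sigma>)) + (1 / s - 1) * ((\<Sum>(i, j)\<in>swaps \<sigma>. ?a i j) + (\<Sum>(i, j)\<in>swaps \<sigma>. ?a j i))
       - (1 - s) * ((\<Sum>(i, j)\<in>swaps \<sigma>. ?c i j) + (\<Sum>(i, j)\<in>swaps \<sigma>. ?c j i)))"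
    unfolding case_prod_unfold by (rule sum_linear_combination[where \<gamma> = 0, simplified])
  moreover have "\<dots> = s ^ X * (N + (1 / s - 1) * (2 * real X * (real f - 1)) - 2 * (1 - s) * (real g - real X))"
    unfolding sum_swaps_flip[of "?a"] sum_swaps_flip[of "?c"] sum_agree_swaps[OF assms(1,2)]
      sum_gain_swaps[OF assms(1,2)] card_swaps[OF assms(1)] X_def
    by (simp add: algebra_simps)
  ultimately show ?thesis by linarith
qed

end

section \<open>The walk: upper bound for the generating function\<close>

text \<open>The next two lemmas bound the error terms of a step: the left-hand sides are, up to the factor
  \<open>2\<close> in the second, the probabilities of one and of two successes in \<open>X\<close> trials, hence bounded
  uniformly in \<open>X\<close>.\<close>
lemma binomial_prob_one_le:
  fixes a s :: real
  assumes "0 \<le> a" "0 \<le> s" "a + s = 1"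
  shows "real X * a * s ^ (X - 1) \<le> 1"
proof (cases "X \<ge> 1")
  case True
  have "real (X choose 1) * a ^ 1 * s ^ (X - 1) \<le> (\<Sum>k\<le>X. real (X choose k) * a ^ k * s ^ (X - k))"
    by (rule member_le_sum) (use assms True in auto)
  also have "\<dots> = 1" using binomial_ring[of a s X] assms by simp
  finally show ?thesis by simp
qed (auto simp: not_le)

lemma binomial_prob_two_le:
  fixes a s :: real
  assumes "0 \<le> a" "0 \<le> s" "a + s = 1"
  shows "real X * (real X - 1) * a\<^sup>2 * s ^ (X - 2) \<le> 2"
proof (cases "X \<ge> 2")
  case True
  have "real (X choose 2) * a ^ 2 * s ^ (X - 2) \<le> (\<Sum>k\<le>X. real (X choose k) * a ^ k * s ^ (X - k))"
    by (rule member_le_sum) (use assms True in auto)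
  also have "\<dots> = 1" using binomial_ring[of a s X] assms by simp
  finally have "real (X choose 2) * a ^ 2 * s ^ (X - 2) \<le> 1" .
  moreover have "real X * (real X - 1) = 2 * real (X choose 2)"
  proof -
    have "even (X * (X - 1))" by (cases X) auto
    then have "2 * (X choose 2) = X * (X - 1)" unfolding choose_two by simp
    then have "real (2 * (X choose 2)) = real (X * (X - 1))" by (rule arg_cong)
    then show ?thesis using True by (simp add: of_nat_diff)
  qed
  ultimately show ?thesis by simp
next
  case False
  then have "X = 0 \<or> X = 1" by auto
  then show ?thesis by auto
qed

context two_block_walk
begin

text \<open>To first order a step multiplies \<open>(1 - a) ^ X\<close> by \<open>1 + (2 f / N) b X - k\<close>, where
  \<open>b = a / (1 - a)\<close>. By Bernoulli's inequality \<open>(1 - a) ^ X * (1 + (2 f / N) b X)\<close> is at most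
  \<open>(1 - a + (2 f / N) a) ^ X\<close>, so that losses shrink the parameter \<open>a\<close> to
  \<open>(1 - 2 f / N) a\<close>. Gains contribute the factor \<open>1 - k\<close>. The simultaneous loss of two agreements and
  the cross term of losses and gains cost \<open>2 / N\<close> and \<open>4 / N\<close>.\<close>
lemma expectation_step_le:
  fixes a :: real
  assumes "\<sigma> \<in> S" "x \<in> S" "0 < a" "a < 1" and N: "2 * real f \<le> N" "real f * real g \<le> N"
  shows "measure_pmf.expectation (transposition_step n M \<sigma>) (\<lambda>\<tau>. (1 - a) ^ matches x \<tau>) \<le>
    (1 - a * (2 - a) * real g / N) * (1 - (1 - 2 * real f / N) * a) ^ matches x \<sigma> + 6 / N"
proof -
  define s where "s = 1 - a"
  define b where "b = 1 / s - 1"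
  define X where "X = matches x \<sigma>"
  define k where "k = a * (2 - a) * real g / N"
  define y where "y = 2 * real f / N * (real X * b)"
  have s: "0 < s" "s < 1" "a = 1 - s" using assms by (auto simp: s_def)
  have b: "b \<ge> 0" "s * b = a" using s by (auto simp: b_def right_diff_distrib)
  have gf: "real g \<le> real f" using g_le_f by simp
  have k: "0 \<le> k" "k \<le> 2 * real g / N" "k \<le> 1"
  proof -
    show "0 \<le> k" using assms N_pos by (simp add: k_def)
    have "a * (2 - a) \<le> 1" using zero_le_power2[of "1 - a"] by (simp add: power2_eq_square algebra_simps)
    then have "a * (2 - a) * real g \<le> 1 * real g" by (intro mult_right_mono) auto
    then have *: "k \<le> real g / N" unfolding k_def using N_pos by (intro divide_right_mono) auto
    also have "\<dots> \<le> 2 * real g / N" using N_pos by (intro divide_right_mono) auto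
    finally show "k \<le> 2 * real g / N" .
    have "real g / N \<le> 1" using N gf N_pos by simp
    then show "k \<le> 1" using * by simp
  qed
  have one: "s ^ X * (real X * b) \<le> 1"
  proof (cases X)
    case (Suc m)
    have "s ^ X * (real X * b) = real X * (s * b) * s ^ (X - 1)" by (simp add: Suc)
    also have "\<dots> \<le> 1" unfolding b by (rule binomial_prob_one_le) (use s in auto)
    finally show ?thesis .
  qed auto
  have two: "s ^ X * (b\<^sup>2 * (real X * (real X - 1))) \<le> 2"
  proof (cases "X \<ge> 2")
    case True
    then obtain m where m: "X = m + 2" using le_Suc_ex[of 2 X] by (auto simp: add.commute)
    have "s ^ X * (b\<^sup>2 * (real X * (real X - 1))) = real X * (real X - 1) * (s * b)\<^sup>2 * s ^ (X - 2)"
      by (simp add: m power_add power_mult_distrib power2_eq_square)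
    also have "\<dots> \<le> 2" unfolding b by (rule binomial_prob_two_le) (use s in auto)
    finally show ?thesis .
  next
    case False
    then have "X = 0 \<or> X = 1" by auto
    then show ?thesis by auto
  qed
  have bern: "s ^ X * (1 + y) \<le> (1 - (1 - 2 * real f / N) * a) ^ X"
  proof -
    have "1 + real X * (2 * real f / N * b) \<le> (1 + 2 * real f / N * b) ^ X"
      by (rule Bernoulli_inequality) (use N_pos b in \<open>auto intro: order_trans[of _ 0]\<close>)
    then have "s ^ X * (1 + y) \<le> s ^ X * (1 + 2 * real f / N * b) ^ X"
      using s by (intro mult_left_mono) (auto simp: y_def algebra_simps)
    also have "\<dots> = (s + 2 * real f / N * (s * b)) ^ X"
      by (simp add: power_mult_distrib[symmetric] algebra_simps)
    also have "s + 2 * real f / N * (s * b) = 1 - (1 - 2 * real f / N) * a"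
      unfolding b by (simp add: s_def algebra_simps)
    finally show ?thesis .
  qed
  (* The loss count has f - 1 where f is wanted, and the gain count has g - X where g is wanted;
    the two corrections together have the right sign. *)
  have slack: "(- 2 * b + a * (1 + s)) * real X \<le> 0"
  proof -
    have "a * (1 + s) = b * (s * (1 + s))" using b by (simp add: algebra_simps)
    also have "\<dots> \<le> b * 2" using b s mult_mono[of s 1 "1 + s" 2] by (intro mult_left_mono) auto
    finally show ?thesis by (intro mult_nonpos_nonneg) auto
  qed
  have "measure_pmf.expectation (transposition_step n M \<sigma>) (\<lambda>\<tau>. (1 - a) ^ matches x \<tau>) =
      (\<Sum>(i, j)\<in>swaps \<sigma>. s ^ matches x (\<sigma> \<circ> Transposition.transpose i j)) / N"
    by (simp add: expectation_step[OF assms(1)] s_def)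
  also have "\<dots> \<le> s ^ X * (N + b * (2 * real X * (real f - 1)) + b\<^sup>2 * (real X * (real X - 1))
     - a * (1 + s) * (real g - real X)) / N"
    using sum_pow_matches_swaps_le[OF assms(1,2), of s] s N_pos
    by (intro divide_right_mono) (auto simp: X_def b_def)
  also have "\<dots> \<le> (s ^ X * (N + 2 * real f * (real X * b) - a * (1 + s) * real g) + 2) / N"
  proof (intro divide_right_mono)
    have "s ^ X * ((- 2 * b + a * (1 + s)) * real X) \<le> 0"
      by (rule mult_nonneg_nonpos[OF _ slack]) (use s in simp)
    then show "s ^ X * (N + b * (2 * real X * (real f - 1)) + b\<^sup>2 * (real X * (real X - 1))
     - a * (1 + s) * (real g - real X)) \<le> s ^ X * (N + 2 * real f * (real X * b) - a * (1 + s) * real g) + 2"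
      using two by (simp add: algebra_simps)
  qed (use N_pos in auto)
  also have "\<dots> = s ^ X * (1 + y - k) + 2 / N"
    using N_pos by (simp add: y_def k_def s_def field_simps)
  also have "s ^ X * (1 + y - k) = (1 - k) * (s ^ X * (1 + y)) + k * (2 * real f / N) * (s ^ X * (real X * b))"
    by (simp add: y_def algebra_simps add_divide_distrib diff_divide_distrib)
  also have "k * (2 * real f / N) * (s ^ X * (real X * b)) \<le> k * (2 * real f / N) * 1"
    using one k N_pos by (intro mult_left_mono) auto
  also have "\<dots> \<le> 2 * real g / N * (2 * real f / N) * 1"
    using k N_pos by (intro mult_right_mono) auto
  also have "\<dots> = 4 / N * (real f * real g / N)" by simp
  also have "\<dots> \<le> 4 / N * 1" using N N_pos by (intro mult_left_mono) auto
  also have "(1 - k) * (s ^ X * (1 + y)) \<le> (1 - k) * (1 - (1 - 2 * real f / N) * a) ^ X"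
    using bern k by (intro mult_left_mono) auto
  finally show ?thesis by (simp add: k_def X_def)
qed

lemma expectation_walk_mono:
  fixes \<phi> \<psi> :: "(nat \<Rightarrow> nat) \<Rightarrow> real"
  assumes "x \<in> S" "\<And>\<sigma>. \<sigma> \<in> S \<Longrightarrow> \<phi> \<sigma> \<le> \<psi> \<sigma>"
  shows "measure_pmf.expectation (transposition_walk n M t x) \<phi> \<le>
    measure_pmf.expectation (transposition_walk n M t x) \<psi>"
  using set_walk[OF assms(1), of t] finite_S assms
  by (intro integral_mono_AE integrable_measure_pmf_finite) (auto simp: AE_measure_pmf_iff intro: finite_subset)

text \<open>The factors \<open>1 - k\<close> met along the parameters \<open>a, q a, q\<^sup>2 a, \<dots>\<close> are collected by the potential
  \<open>\<psi>\<close>, since \<open>k \<ge> (g / f) * (\<psi> a - \<psi> (q a))\<close>. This requires the coefficient \<open>\<eta>\<close> of \<open>a\<^sup>2\<close> in \<open>\<psi>\<close> to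
  satisfy \<open>\<eta> * (1 + q) \<ge> 1 / 2\<close>; the value \<open>1 / 3\<close> suits every \<open>q \<ge> 1 / 2\<close>, and \<open>1 / 4\<close> would be the
  limit for \<open>q\<close> near \<open>1\<close>.\<close>
lemma expectation_walk_le:
  fixes a :: real
  assumes "x \<in> S" "0 < a" "a < 1" and f: "0 < f" and N: "4 * real f \<le> N" "real f * real g \<le> N"
  defines "q \<equiv> 1 - 2 * real f / N" and "\<psi> \<equiv> (\<lambda>a::real. a - a\<^sup>2 / 3)"
  shows "measure_pmf.expectation (transposition_walk n M t x) (\<lambda>\<tau>. (1 - a) ^ matches x \<tau>) \<le>
    (1 - q ^ t * a) ^ g * exp (- (real g / real f) * (\<psi> a - \<psi> (q ^ t * a))) + 6 * real t / N"
  using assms(2,3)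
proof (induction t arbitrary: a)
  case 0
  have "agree x x = small x" by (auto simp: agree_def)
  then show ?case using card_small[OF assms(1)] by simp
next
  case (Suc t)
  define k where "k = a * (2 - a) * real g / N"
  have q: "1 / 2 \<le> q" "q \<le> 1" using N N_pos by (auto simp: q_def field_simps)
  have qa: "0 < q * a" "q * a < 1"
    using q Suc.prems by (auto intro: le_less_trans[OF mult_left_le_one_le])
  have k0: "0 \<le> k" using Suc.prems N_pos by (simp add: k_def)
  have k1: "k \<le> 1"
  proof -
    have "a * (2 - a) \<le> 1" using zero_le_power2[of "1 - a"] by (simp add: power2_eq_square algebra_simps)
    then have "a * (2 - a) * real g \<le> 1 * real g" by (intro mult_right_mono) auto
    also have "\<dots> \<le> N" using N g_le_f by linarith
    finally show ?thesis using N_pos by (simp add: k_def)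
  qed
  have k: "(real g / real f) * (\<psi> a - \<psi> (q * a)) \<le> k"
  proof -
    have "\<psi> a - \<psi> (q * a) = (1 - q) * (a - (1 + q) / 3 * a\<^sup>2)"
      by (simp add: \<psi>_def power2_eq_square field_simps)
    also have "(real g / real f) * \<dots> = 2 * real g / N * (a - (1 + q) / 3 * a\<^sup>2)"
      using f by (simp add: q_def)
    also have "\<dots> \<le> 2 * real g / N * (a - 1 / 2 * a\<^sup>2)"
      using q N_pos by (intro mult_left_mono diff_left_mono mult_right_mono) auto
    also have "\<dots> = k" by (simp add: k_def power2_eq_square algebra_simps diff_divide_distrib)
    finally show ?thesis .
  qed
  let ?E = "measure_pmf.expectation (transposition_walk n M t x)"
  have fin: "finite (set_pmf (transposition_walk n M t x))"
    using set_walk[OF assms(1)] finite_S by (rule finite_subset)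
  have "measure_pmf.expectation (transposition_walk n M (Suc t) x) (\<lambda>\<tau>. (1 - a) ^ matches x \<tau>) =
    ?E (\<lambda>\<sigma>. measure_pmf.expectation (transposition_step n M \<sigma>) (\<lambda>\<tau>. (1 - a) ^ matches x \<tau>))"
    by (rule expectation_walk_Suc[OF assms(1)])
  also have "\<dots> \<le> ?E (\<lambda>\<sigma>. (1 - k) * (1 - q * a) ^ matches x \<sigma> + 6 / N)"
    unfolding k_def q_def
    by (rule expectation_walk_mono[OF assms(1)], rule expectation_step_le) (use assms Suc.prems in auto)
  also have "\<dots> = (1 - k) * ?E (\<lambda>\<sigma>. (1 - q * a) ^ matches x \<sigma>) + 6 / N"
    using fin by (subst Bochner_Integration.integral_add)
      (auto intro!: integrable_measure_pmf_finite)
  also have "(1 - k) * ?E (\<lambda>\<sigma>. (1 - q * a) ^ matches x \<sigma>) \<le> (1 - k) *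
    ((1 - q ^ t * (q * a)) ^ g * exp (- (real g / real f) * (\<psi> (q * a) - \<psi> (q ^ t * (q * a)))) + 6 * real t / N)"
    (is "_ \<le> _ * (?A * exp ?B + _)") using k1 by (intro mult_left_mono Suc.IH[OF qa]) auto
  also have "(1 - k) * (?A * exp ?B + 6 * real t / N) \<le> ?A * (exp (- k) * exp ?B) + 6 * real t / N"
  proof -
    have A: "?A \<ge> 0"
    proof -
      have "q ^ t * (q * a) \<le> 1" using mult_le_one[of "q ^ t" "q * a"] q qa power_le_one[of q t] by simp
      then show ?thesis by simp
    qed
    have "(1 - k) * (?A * exp ?B) \<le> exp (- k) * (?A * exp ?B)"
      using A exp_ge_add_one_self[of "- k"] by (intro mult_right_mono) auto
    moreover have "(1 - k) * (6 * real t / N) \<le> 1 * (6 * real t / N)"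
      using k0 N_pos by (intro mult_right_mono) auto
    ultimately show ?thesis by (simp add: algebra_simps)
  qed
  also have "?A * (exp (- k) * exp ?B) \<le> ?A * exp (- (real g / real f) * (\<psi> a - \<psi> (q ^ t * (q * a))))"
  proof (rule mult_left_mono)
    have "- k + ?B \<le> - (real g / real f) * (\<psi> a - \<psi> (q ^ t * (q * a)))"
      using k by (simp add: algebra_simps)
    then show "exp (- k) * exp ?B \<le> exp (- (real g / real f) * (\<psi> a - \<psi> (q ^ t * (q * a))))"
      by (simp add: exp_add[symmetric])
    have "q ^ t * (q * a) \<le> 1" using mult_le_one[of "q ^ t" "q * a"] q qa power_le_one[of q t] by simp
    then show "?A \<ge> 0" by simp
  qed
  finally show ?case by (simp add: algebra_simps add_divide_distrib)
qed

end

section \<open>The uniform distribution: lower bound for the generating function\<close>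

context two_block_walk
begin

text \<open>Invariance of the uniform distribution: exchanging the same two positions again is an
  involution on the pairs of a state and an admissible exchange.\<close>
lemma sum_over_swaps:
  fixes \<phi> :: "(nat \<Rightarrow> nat) \<Rightarrow> real"
  shows "(\<Sum>\<sigma>\<in>S. \<Sum>(i, j)\<in>swaps \<sigma>. \<phi> (\<sigma> \<circ> Transposition.transpose i j)) = N * (\<Sum>\<sigma>\<in>S. \<phi> \<sigma>)"
proof -
  let ?h = "\<lambda>(\<sigma>, i, j). (\<sigma> \<circ> Transposition.transpose i j, i, j) :: (nat \<Rightarrow> nat) \<times> nat \<times> nat"
  have inv: "(\<sigma> \<circ> Transposition.transpose i j) \<circ> Transposition.transpose i j = \<sigma>" for \<sigma> :: "nat \<Rightarrow> nat" and i j
    by (simp add: comp_assoc)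
  have "(\<Sum>\<sigma>\<in>S. \<Sum>(i, j)\<in>swaps \<sigma>. \<phi> (\<sigma> \<circ> Transposition.transpose i j)) =
    (\<Sum>(\<sigma>, i, j)\<in>Sigma S swaps. \<phi> (\<sigma> \<circ> Transposition.transpose i j))"
    by (subst sum.Sigma) (auto simp: finite_S)
  also have "\<dots> = (\<Sum>(\<sigma>, i, j)\<in>Sigma S swaps. \<phi> \<sigma>)"
    by (rule sum.reindex_bij_witness[of _ ?h ?h]) (auto simp: swaps_def inv)
  also have "\<dots> = (\<Sum>\<sigma>\<in>S. \<Sum>(i, j)\<in>swaps \<sigma>. \<phi> \<sigma>)"
    by (subst sum.Sigma) (auto simp: finite_S)
  also have "\<dots> = N * (\<Sum>\<sigma>\<in>S. \<phi> \<sigma>)"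
    by (simp add: card_swaps sum_distrib_left case_prod_unfold)
  finally show ?thesis .
qed

text \<open>In equilibrium the gains and losses of \<open>s ^ X\<close> balance. With \<open>W s = (\<Sum>\<sigma>\<in>S. s ^ X)\<close>, the losses
  contribute at least \<open>2 (1 - s) (f - 1) W'\<close> and the gains remove at most \<open>2 (1 - s) g W\<close>.\<close>
lemma sum_pow_matches_deriv_le:
  fixes s :: real
  assumes "x \<in> S" "0 < s" "s < 1"
  shows "(real f - 1) * (\<Sum>\<sigma>\<in>S. real (matches x \<sigma>) * s ^ (matches x \<sigma> - 1)) \<le>
    real g * (\<Sum>\<sigma>\<in>S. s ^ matches x \<sigma>)"
proof -
  let ?X = "matches x" and ?a = "1 - s"
  have bound: "N * s ^ ?X \<sigma> + 2 * ?a * ((real f - 1) * (real (?X \<sigma>) * s ^ (?X \<sigma> - 1)) - real g * s ^ ?X \<sigma>) \<le>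
     (\<Sum>(i, j)\<in>swaps \<sigma>. s ^ ?X (\<sigma> \<circ> Transposition.transpose i j))" if "\<sigma> \<in> S" for \<sigma>
  proof -
    have "s ^ ?X \<sigma> * ((1 / s - 1) * real (?X \<sigma>)) = ?a * (real (?X \<sigma>) * s ^ (?X \<sigma> - 1))"
      using assms by (cases "?X \<sigma>") (auto simp: field_simps)
    note key = this
    have "s ^ ?X \<sigma> * (N + (1 / s - 1) * (2 * real (?X \<sigma>) * (real f - 1)) - 2 * ?a * (real g - real (?X \<sigma>))) =
      N * s ^ ?X \<sigma> + 2 * (real f - 1) * (s ^ ?X \<sigma> * ((1 / s - 1) * real (?X \<sigma>)))
      - 2 * ?a * (real g * s ^ ?X \<sigma>) + 2 * ?a * (s ^ ?X \<sigma> * real (?X \<sigma>))"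
      by algebra
    then have "s ^ ?X \<sigma> * (N + (1 / s - 1) * (2 * real (?X \<sigma>) * (real f - 1)) - 2 * ?a * (real g - real (?X \<sigma>))) =
      N * s ^ ?X \<sigma> + 2 * ?a * ((real f - 1) * (real (?X \<sigma>) * s ^ (?X \<sigma> - 1)) - real g * s ^ ?X \<sigma>)
       + 2 * ?a * (s ^ ?X \<sigma> * real (?X \<sigma>))"
      unfolding key by (simp only: algebra_simps)
    moreover have "2 * ?a * (s ^ ?X \<sigma> * real (?X \<sigma>)) \<ge> 0" using assms by simp
    ultimately show ?thesis
      using sum_pow_matches_swaps_ge[OF that assms(1,2)] assms by linarith
  qed
  have "(\<Sum>\<sigma>\<in>S. N * s ^ ?X \<sigma> + 2 * ?a * ((real f - 1) * (real (?X \<sigma>) * s ^ (?X \<sigma> - 1)) - real g * s ^ ?X \<sigma>))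
    \<le> (\<Sum>\<sigma>\<in>S. \<Sum>(i, j)\<in>swaps \<sigma>. s ^ ?X (\<sigma> \<circ> Transposition.transpose i j))"
    by (rule sum_mono) (rule bound)
  also have "\<dots> = N * (\<Sum>\<sigma>\<in>S. s ^ ?X \<sigma>)" by (rule sum_over_swaps)
  finally have "2 * ?a * ((real f - 1) * (\<Sum>\<sigma>\<in>S. real (?X \<sigma>) * s ^ (?X \<sigma> - 1)) - real g * (\<Sum>\<sigma>\<in>S. s ^ ?X \<sigma>)) \<le> 0"
    by (simp add: sum.distrib sum_subtractf sum_distrib_left[symmetric])
  then show ?thesis using assms by (simp add: mult_le_0_iff)
qed

text \<open>Integration of the previous inequality from \<open>s\<close> to \<open>1\<close>, where the sum is \<open>card S\<close>.\<close>
lemma sum_pow_matches_ge: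
  fixes s :: real
  assumes "x \<in> S" "0 < s" "s < 1" "f \<ge> 2"
  shows "real (card S) * exp (- (1 - s) * (real g / (real f - 1))) \<le> (\<Sum>\<sigma>\<in>S. s ^ matches x \<sigma>)"
proof -
  define \<kappa> where "\<kappa> = real g / (real f - 1)"
  define h where "h = (\<lambda>s. (\<Sum>\<sigma>\<in>S. s ^ matches x \<sigma>) * exp (- \<kappa> * s))"
  have "h 1 \<le> h s"
  proof (rule DERIV_nonpos_imp_decreasing_open[of s 1 h])
    fix u :: real assume u: "s < u" "u < 1"
    let ?W = "\<Sum>\<sigma>\<in>S. u ^ matches x \<sigma>" and ?W' = "\<Sum>\<sigma>\<in>S. real (matches x \<sigma>) * u ^ (matches x \<sigma> - 1)"
    have "(h has_real_derivative ((?W' - \<kappa> * ?W) * exp (- \<kappa> * u))) (at u)"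
      unfolding h_def by (auto intro!: derivative_eq_intros simp: algebra_simps)
    moreover have "?W' \<le> \<kappa> * ?W"
      using sum_pow_matches_deriv_le[OF assms(1), of u] u assms by (simp add: \<kappa>_def field_simps)
    then have "(?W' - \<kappa> * ?W) * exp (- \<kappa> * u) \<le> 0" by (intro mult_nonpos_nonneg) auto
    ultimately show "\<exists>y. (h has_real_derivative y) (at u) \<and> y \<le> 0" by blast
  next
    show "continuous_on {s..1} h" unfolding h_def by (intro continuous_intros)
  qed (use assms in auto)
  then have "real (card S) * exp (- \<kappa>) * exp (\<kappa> * s) \<le> (\<Sum>\<sigma>\<in>S. s ^ matches x \<sigma>) * exp (- \<kappa> * s) * exp (\<kappa> * s)"
    unfolding h_def by (intro mult_right_mono) auto
  moreover have "exp (- \<kappa>) * exp (\<kappa> * s) = exp (- (1 - s) * \<kappa>)" "exp (- \<kappa> * s) * exp (\<kappa> * s) = 1"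
    by (simp_all add: exp_add[symmetric] algebra_simps)
  ultimately show ?thesis by (simp only: mult.assoc \<kappa>_def[symmetric] mult_1_right)
qed

lemma expectation_stationary_ge:
  fixes s :: real
  assumes "x \<in> S" "0 < s" "s < 1" "f \<ge> 2"
  shows "exp (- (1 - s) * (real g / (real f - 1))) \<le>
    measure_pmf.expectation (stationary_dist n M) (\<lambda>\<sigma>. s ^ matches x \<sigma>)"
proof -
  have "card S > 0" "S \<noteq> {}" using assms(1) finite_S card_gt_0_iff by auto
  then show ?thesis
    using sum_pow_matches_ge[OF assms] finite_S
    by (simp add: stationary_dist_def S_def[symmetric] integral_pmf_of_set field_simps)
qed

end

section \<open>From generating functions to total variation distance\<close>

text \<open>Both distributions have total mass \<open>1\<close>, so \<open>\<phi>\<close> may be replaced by \<open>\<phi> - 1 / 2\<close>, which is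
  bounded by \<open>1 / 2\<close> in absolute value.\<close>
lemma expectation_diff_le_tv_dist:
  fixes \<mu> \<nu> :: "'a pmf" and \<phi> :: "'a \<Rightarrow> real"
  assumes "finite A" "set_pmf \<mu> \<subseteq> A" "set_pmf \<nu> \<subseteq> A"
    and "\<And>x. x \<in> A \<Longrightarrow> 0 \<le> \<phi> x" "\<And>x. x \<in> A \<Longrightarrow> \<phi> x \<le> 1"
  shows "measure_pmf.expectation \<nu> \<phi> - measure_pmf.expectation \<mu> \<phi> \<le> tv_dist \<mu> \<nu>"
proof -
  have tv: "tv_dist \<mu> \<nu> = 1 / 2 * (\<Sum>x\<in>A. \<bar>pmf \<mu> x - pmf \<nu> x\<bar>)"
  proof -
    have "pmf \<mu> x = 0" "pmf \<nu> x = 0" if "x \<notin> A" for x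
      using assms(2,3) that by (auto simp: set_pmf_iff)
    then have "(\<Sum>\<^sub>\<infinity>x. \<bar>pmf \<mu> x - pmf \<nu> x\<bar>) = (\<Sum>\<^sub>\<infinity>x\<in>A. \<bar>pmf \<mu> x - pmf \<nu> x\<bar>)"
      by (intro infsum_cong_neutral) auto
    then show ?thesis using assms(1) by (simp add: tv_dist_def)
  qed
  have E: "measure_pmf.expectation \<mu> \<phi> = (\<Sum>x\<in>A. pmf \<mu> x * \<phi> x)"
    "measure_pmf.expectation \<nu> \<phi> = (\<Sum>x\<in>A. pmf \<nu> x * \<phi> x)"
    by (subst integral_measure_pmf[OF assms(1)]; use assms in auto)+
  have "(\<Sum>x\<in>A. (pmf \<nu> x - pmf \<mu> x) * (1 / 2)) = 0"
    by (simp only: sum_distrib_right[symmetric] sum_subtractf sum_pmf_eq_1[OF assms(1,2)] sum_pmf_eq_1[OF assms(1,3)])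
       simp
  then have "measure_pmf.expectation \<nu> \<phi> - measure_pmf.expectation \<mu> \<phi> = (\<Sum>x\<in>A. (pmf \<nu> x - pmf \<mu> x) * (\<phi> x - 1 / 2))"
    unfolding E by (simp add: algebra_simps sum_subtractf sum.distrib)
  also have "\<dots> \<le> (\<Sum>x\<in>A. \<bar>pmf \<mu> x - pmf \<nu> x\<bar> * (1 / 2))"
  proof (rule sum_mono)
    fix x assume "x \<in> A"
    then have "\<bar>\<phi> x - 1 / 2\<bar> \<le> 1 / 2" using assms(4,5)[of x] by (auto simp: abs_if)
    then have "\<bar>pmf \<nu> x - pmf \<mu> x\<bar> * \<bar>\<phi> x - 1 / 2\<bar> \<le> \<bar>pmf \<nu> x - pmf \<mu> x\<bar> * (1 / 2)"
      by (rule mult_left_mono) simp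
    then show "(pmf \<nu> x - pmf \<mu> x) * (\<phi> x - 1 / 2) \<le> \<bar>pmf \<mu> x - pmf \<nu> x\<bar> * (1 / 2)"
      using abs_ge_self[of "(pmf \<nu> x - pmf \<mu> x) * (\<phi> x - 1 / 2)"] by (simp add: abs_mult abs_minus_commute)
  qed
  also have "\<dots> = tv_dist \<mu> \<nu>" unfolding tv by (simp only: sum_distrib_right[symmetric] mult.commute[of "1 / 2"])
  finally show ?thesis .
qed

lemma one_minus_power_ge_exp:
  fixes y L :: real
  assumes "0 \<le> y" "y \<le> 1 / 2" "real t * y \<le> L / 2"
  shows "exp (- L / 2 * (1 + 2 * y)) \<le> (1 - y) ^ t"
proof -
  have "real t * y * (1 + 2 * y) \<le> L / 2 * (1 + 2 * y)"
    using assms by (intro mult_right_mono) auto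
  moreover have "real t * (- y - 2 * y\<^sup>2) \<le> real t * ln (1 - y)"
    using ln_one_minus_pos_lower_bound[of y] assms by (intro mult_left_mono) auto
  ultimately have "- L / 2 * (1 + 2 * y) \<le> real t * ln (1 - y)"
    by (simp add: power2_eq_square algebra_simps)
  then have "exp (- L / 2 * (1 + 2 * y)) \<le> exp (real t * ln (1 - y))" by simp
  also have "\<dots> = (1 - y) ^ t" using assms by (simp add: exp_of_nat_mult)
  finally show ?thesis .
qed

context two_block_walk
begin

text \<open>The generating functions at \<open>1 / 2\<close> are compared; \<open>5 / 12\<close> is \<open>\<psi> (1 / 2)\<close>. The unwanted term
  \<open>\<rho> * \<psi> (u / 2)\<close> in the exponent is absorbed by giving up one of the \<open>g\<close> small values, because
  \<open>\<rho> \<le> 1\<close>.\<close>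
lemma tv_dist_walk_ge:
  fixes t :: nat
  assumes "x \<in> S" "f \<ge> 2" and N: "4 * real f \<le> N" "real f * real g \<le> N"
  defines "u \<equiv> (1 - 2 * real f / N) ^ t" and "\<rho> \<equiv> real g / real f"
  shows "tv_dist (transposition_walk n M t x) (stationary_dist n M) \<ge>
    exp (- real g / (2 * (real f - 1))) - exp (- 5 / 12 * \<rho> - (real g - 1) * u / 2) - 6 * real t / N"
proof -
  let ?\<phi> = "\<lambda>\<sigma>. (1 / 2 :: real) ^ matches x \<sigma>"
  have S: "S \<noteq> {}" using assms(1) by auto
  have u: "0 \<le> u" "u \<le> 1"
  proof -
    have "0 \<le> 1 - 2 * real f / N" "1 - 2 * real f / N \<le> 1" using N N_pos by (auto simp: field_simps)
    then show "0 \<le> u" "u \<le> 1" unfolding u_def by (auto intro: power_le_one)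
  qed
  have \<rho>: "0 \<le> \<rho>" "\<rho> \<le> 1" using g_le_f assms(2) by (auto simp: \<rho>_def)
  have "measure_pmf.expectation (transposition_walk n M t x) ?\<phi> \<le>
    (1 - u * (1 / 2)) ^ g * exp (- \<rho> * ((1 / 2 - (1 / 2)\<^sup>2 / 3) - (u * (1 / 2) - (u * (1 / 2))\<^sup>2 / 3))) + 6 * real t / N"
    using expectation_walk_le[OF assms(1), of "1 / 2" t] assms(2) N
    by (simp add: u_def \<rho>_def del: power_divide)
  also have "(1 - u * (1 / 2)) ^ g \<le> exp (- (u / 2)) ^ g"
    using u exp_ge_add_one_self[of "- (u / 2)"] by (intro power_mono) auto
  also have "exp (- (u / 2)) ^ g = exp (- real g * u / 2)"
    by (simp add: exp_of_nat_mult[symmetric])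
  also have "exp (- real g * u / 2) * exp (- \<rho> * ((1 / 2 - (1 / 2)\<^sup>2 / 3) - (u * (1 / 2) - (u * (1 / 2))\<^sup>2 / 3)))
    \<le> exp (- 5 / 12 * \<rho> - (real g - 1) * u / 2)"
  proof -
    have "\<rho> * (u * (1 / 2) - (u * (1 / 2))\<^sup>2 / 3) \<le> 1 * (u / 2)"
    proof (cases "u * (1 / 2) - (u * (1 / 2))\<^sup>2 / 3 \<ge> 0")
      case True
      then have "\<rho> * (u * (1 / 2) - (u * (1 / 2))\<^sup>2 / 3) \<le> 1 * (u * (1 / 2) - (u * (1 / 2))\<^sup>2 / 3)"
        using \<rho> by (intro mult_right_mono) auto
      then show ?thesis by (smt (verit) zero_le_power2 divide_nonneg_nonneg mult_cancel_left1 times_divide_eq_right)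
    next
      case False
      then have "\<rho> * (u * (1 / 2) - (u * (1 / 2))\<^sup>2 / 3) \<le> 0" using \<rho> by (intro mult_nonneg_nonpos) auto
      then show ?thesis using u by linarith
    qed
    then have "- real g * u / 2 + - \<rho> * ((1 / 2 - (1 / 2)\<^sup>2 / 3) - (u * (1 / 2) - (u * (1 / 2))\<^sup>2 / 3))
      \<le> - 5 / 12 * \<rho> - (real g - 1) * u / 2"
      by (simp add: field_simps power2_eq_square)
    then show ?thesis by (simp add: exp_add[symmetric])
  qed
  finally have walk: "measure_pmf.expectation (transposition_walk n M t x) ?\<phi> \<le>
     exp (- 5 / 12 * \<rho> - (real g - 1) * u / 2) + 6 * real t / N" by simp
  have "exp (- real g / (2 * (real f - 1))) \<le> measure_pmf.expectation (stationary_dist n M) ?\<phi>"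
    using expectation_stationary_ge[OF assms(1), of "1 / 2"] assms(2) by simp
  moreover have "measure_pmf.expectation (stationary_dist n M) ?\<phi> - measure_pmf.expectation (transposition_walk n M t x) ?\<phi>
    \<le> tv_dist (transposition_walk n M t x) (stationary_dist n M)"
    by (rule expectation_diff_le_tv_dist[OF finite_S set_walk[OF assms(1)]])
      (use finite_S S in \<open>auto simp: stationary_dist_def S_def[symmetric] power_le_one\<close>)
  ultimately show ?thesis using walk by linarith
qed

lemma N_ge: assumes "4 * f \<le> n" shows "real n ^ 2 / 2 \<le> N"
proof -
  have "2 * real g * (real n - real f) \<le> 2 * (real n / 4) * real n"
    using assms g_le_f by (intro mult_mono) auto
  then show ?thesis by (simp add: N_def power2_eq_square)
qed

text \<open>Here \<open>L\<close> stands for \<open>ln g + ln f - c\<close>, so that \<open>exp (- L / 2) = exp (c / 2) / sqrt (g f)\<close>, and \<open>\<mu>\<close>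
  is a lower bound for the expected number of surviving original agreements. The ratio \<open>\<rho>\<close> is eliminated:
  \<open>exp (- \<rho> / 2) * (\<delta> - exp (\<rho> / 12 - \<mu> / 2))\<close> with \<open>\<delta> = exp (- 1 / (2 * (f - 1)))\<close> is smallest at
  \<open>\<rho> = 1\<close>, provided that the bracket is nonnegative there, which is the last hypothesis.\<close>
lemma tv_dist_walk_ge_of_time_le:
  fixes L \<mu> :: real and t :: nat
  assumes "x \<in> S" "f \<ge> 2" "g \<ge> 1" "4 * f \<le> n" and t: "real t \<le> N / (4 * real f) * L" and L: "0 \<le> L"
    and \<mu>: "\<mu> \<le> (real g - 1) * exp (- L / 2) * exp (- L / real n)"
    and gap: "exp (1 / 12 - \<mu> / 2) \<le> exp (- 1 / (2 * (real f - 1)))"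
  shows "exp (- 1 / 2) * (exp (- 1 / (2 * (real f - 1))) - exp (1 / 12 - \<mu> / 2)) - 3 / 2 * L / real f
    \<le> tv_dist (transposition_walk n M t x) (stationary_dist n M)"
proof -
  define y where "y = 2 * real f / N"
  define \<rho> where "\<rho> = real g / real f"
  have n: "real n \<ge> 8" "4 * real f \<le> real n" using assms(2,4) by auto
  have Nn: "real n * real n / 2 \<le> N" using N_ge[OF assms(4)] by (simp add: power2_eq_square)
  have nn: "8 * real n \<le> real n * real n" using n by (intro mult_right_mono) auto
  have N1: "4 * real f \<le> N" using Nn nn n by linarith
  have "real f * real g \<le> (real n / 4) * (real n / 4)" using n g_le_f by (intro mult_mono) auto
  then have "real f * real g \<le> real n * real n / 16" by simp
  then have N2: "real f * real g \<le> N" using Nn nn n by linarith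
  have y: "0 \<le> y" "y \<le> 1 / 2" using N_pos N1 by (auto simp: y_def field_simps)
  have yn: "y \<le> 1 / real n"
  proof -
    have "2 * real f * real n \<le> real n * real n / 2" using n mult_right_mono[of "4 * real f" "real n" "real n"] by simp
    then have "2 * real f * real n \<le> N" using Nn by linarith
    then show ?thesis using N_pos n by (simp add: y_def field_simps)
  qed
  have "real t * y \<le> N / (4 * real f) * L * y" using t y by (intro mult_right_mono) auto
  also have "\<dots> = L / 2" using N_pos assms(2) by (simp add: y_def field_simps)
  finally have "exp (- L / 2 * (1 + 2 * y)) \<le> (1 - y) ^ t" by (rule one_minus_power_ge_exp[OF y])
  moreover have "exp (- L / 2) * exp (- L / real n) \<le> exp (- L / 2 * (1 + 2 * y))"
    using mult_left_mono[OF yn L] by (simp add: exp_add[symmetric] algebra_simps)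
  ultimately have "(real g - 1) * (exp (- L / 2) * exp (- L / real n)) \<le> (real g - 1) * (1 - y) ^ t"
    using assms(3) by (intro mult_left_mono) auto
  then have \<mu>': "\<mu> \<le> (real g - 1) * (1 - y) ^ t" using \<mu> by (simp add: mult.assoc)
  have time: "6 * real t / N \<le> 3 / 2 * L / real f"
    using t N_pos assms(2) by (simp add: field_simps)
  have \<rho>: "0 \<le> \<rho>" "\<rho> \<le> 1" using g_le_f assms(2) by (auto simp: \<rho>_def)
  let ?d = "exp (- 1 / (2 * (real f - 1)))"
  have "exp (- \<rho> / 2) * ?d \<le> exp (- real g / (2 * (real f - 1)))"
  proof -
    have "real g = \<rho> * (real f - 1) + \<rho>" using assms(2) by (simp add: \<rho>_def field_simps)
    also have "\<dots> \<le> \<rho> * (real f - 1) + 1" using \<rho> by simp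
    finally have "real g / (2 * (real f - 1)) \<le> (\<rho> * (real f - 1) + 1) / (2 * (real f - 1))"
      using assms(2) by (intro divide_right_mono) auto
    also have "\<dots> = \<rho> / 2 + 1 / (2 * (real f - 1))" using assms(2) by (simp add: field_simps)
    finally show ?thesis by (simp add: exp_add[symmetric])
  qed
  moreover have "exp (- 5 / 12 * \<rho> - (real g - 1) * (1 - y) ^ t / 2) \<le> exp (- \<rho> / 2) * exp (1 / 12 - \<mu> / 2)"
    using \<mu>' \<rho> by (simp add: exp_add[symmetric])
  moreover have "exp (- 1 / 2) * (?d - exp (1 / 12 - \<mu> / 2)) \<le> exp (- \<rho> / 2) * (?d - exp (1 / 12 - \<mu> / 2))"
    using \<rho> gap by (intro mult_right_mono) auto
  moreover have "exp (- real g / (2 * (real f - 1))) - exp (- 5 / 12 * \<rho> - (real g - 1) * (1 - y) ^ t / 2) - 6 * real t / N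
     \<le> tv_dist (transposition_walk n M t x) (stationary_dist n M)"
    using tv_dist_walk_ge[OF assms(1,2) N1 N2, of t] by (simp add: y_def \<rho>_def)
  ultimately show ?thesis using time by (simp add: algebra_simps)
qed

lemma N_eq_graph_degree:
  "real n + 2 * graph_degree n (\<lambda>i. if i \<le> f then 1 else g + 1) = N"
proof -
  have "(\<Sum>i=1..n. real (if i \<le> f then 1 else g + 1)) = (\<Sum>i=1..f. 1) + (\<Sum>i=f+1..n. real g + 1)"
  proof -
    have "{1..n} = {1..f} \<union> {f+1..n}" using f_less_n by auto
    then show ?thesis by (simp add: sum.union_disjoint)
  qed
  also have "\<dots> = real f + (real n - real f) * (real g + 1)" using f_less_n by (simp add: of_nat_diff)
  finally have "(\<Sum>i=1..n. real (if i \<le> f then 1 else g + 1)) = real f + (real n - real f) * (real g + 1)" .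
  moreover have "(\<Sum>i=1..n. real i) = real n * (real n + 1) / 2"
    using double_gauss_sum_from_Suc_0[of n, where 'a = real] by simp
  ultimately show ?thesis
    by (simp add: graph_degree_def sum_subtractf N_def power2_eq_square field_simps)
qed

end

section \<open>A numerical inequality\<close>

lemma exp_chord_le:
  fixes x y \<theta> :: real
  assumes "0 \<le> \<theta>" "\<theta> \<le> 1"
  shows "exp ((1 - \<theta>) * x + \<theta> * y) \<le> (1 - \<theta>) * exp x + \<theta> * exp y"
  using convex_onD[OF exp_convex, of \<theta> x y] assms by simp

text \<open>All exponentials needed for the numerical inequality are powers of \<open>exp (- 1 / 12)\<close>, so these
  bounds determine them with enough precision.\<close>
lemma exp_minus_twelfth_bounds:
  "(92004 / 100000 :: real) < exp (- 1 / 12)" "exp (- 1 / 12) < (92005 / 100000 :: real)"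
proof -
  have z: "exp (- 1 / 12) ^ 12 = exp (- 1 :: real)"
    by (simp add: exp_of_nat_mult[symmetric])
  have e: "exp 1 < (271829 / 100000 :: real)" "(271828 / 100000 :: real) < exp 1"
    using abs_le_D1[OF e_approx_32] abs_le_D2[OF e_approx_32] by simp_all
  have "(92004 / 100000 :: real) ^ 12 < 100000 / 271829" by (simp add: field_simps)
  also have "\<dots> < exp (- 1)" using e by (simp add: exp_minus field_simps)
  finally show "(92004 / 100000 :: real) < exp (- 1 / 12)"
    unfolding z[symmetric] by (rule power_less_imp_less_base) simp
  have "exp (- 1) < (100000 / 271828 :: real)" using e by (simp add: exp_minus field_simps)
  also have "\<dots> < (92005 / 100000) ^ 12" by (simp add: field_simps)
  finally show "exp (- 1 / 12) < (92005 / 100000 :: real)"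
    unfolding z[symmetric] by (rule power_less_imp_less_base) simp
qed

text \<open>On \<open>[1, 3/2]\<close> and on \<open>[3/2, 2]\<close> the convex function \<open>exp (- 5 / 12 - \<mu> / 2)\<close> is bounded above by its
  chord, and \<open>exp (- \<mu>\<^sup>2)\<close> is bounded below through \<open>1 + h \<le> exp h\<close> at \<open>\<mu>\<^sup>2 = 7/4\<close> and
  \<open>\<mu>\<^sup>2 = 13/4\<close> respectively. What remains is linear in the position \<open>\<theta>\<close> within the interval,
  hence has to be checked at the two ends only. On \<open>[2, 13/6]\<close> monotonicity suffices, and from
  \<open>13/6\<close> on the term \<open>exp (- \<mu>\<^sup>2)\<close> can be dropped. The margin is below \<open>1/50\<close> around \<open>\<mu> = 2\<close>.\<close>
lemma exp_gap_inequality: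
  fixes \<mu> :: real
  assumes "\<mu> \<ge> 1"
  shows "exp (- 1) + exp (- 5 / 12 - \<mu> / 2) < exp (- 1 / 2) + exp (- \<mu>\<^sup>2)"
proof -
  define z where "z = exp (- 1 / 12 :: real)"
  have z_pow: "exp (- real k / 12) = z ^ k" for k
    by (simp add: z_def exp_of_nat_mult[symmetric])
  have lo: "v \<le> z ^ k" if "v \<le> (92004 / 100000) ^ k" for k and v :: real
    using exp_minus_twelfth_bounds by (intro order_trans[OF that]) (auto simp: z_def intro!: power_mono)
  have hi: "z ^ k \<le> v" if "(92005 / 100000) ^ k \<le> v" for k and v :: real
    using exp_minus_twelfth_bounds by (intro order_trans[OF _ that]) (auto simp: z_def intro!: power_mono)
  have z6: "6065 / 10000 \<le> z ^ 6" by (rule lo) (simp add: power_divide)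
  have z11: "z ^ 11 \<le> 3999 / 10000" by (rule hi) (simp add: power_divide)
  have z12: "z ^ 12 \<le> 36792 / 100000" by (rule hi) (simp add: power_divide)
  have z14: "z ^ 14 \<le> 3115 / 10000" by (rule hi) (simp add: power_divide)
  have z17: "z ^ 17 \<le> 2426 / 10000" by (rule hi) (simp add: power_divide)
  have z18: "z ^ 18 \<le> 2232 / 10000" by (rule hi) (simp add: power_divide)
  have z21: "1737 / 10000 \<le> z ^ 21" by (rule lo) (simp add: power_divide)
  have z39: "387 / 10000 \<le> z ^ 39" by (rule lo) (simp add: power_divide)
  have z57: "86 / 10000 \<le> z ^ 57" by (rule lo) (simp add: power_divide)
  have const: "exp (- 1) = z ^ 12" "exp (- 1 / 2) = z ^ 6"
    using z_pow[of 12] z_pow[of 6] by simp_all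
  consider "\<mu> \<le> 3 / 2" | "3 / 2 \<le> \<mu>" "\<mu> \<le> 2" | "2 \<le> \<mu>" "\<mu> \<le> 13 / 6" | "13 / 6 \<le> \<mu>" by linarith
  then show ?thesis
  proof cases
    case 1
    define \<theta> where "\<theta> = 2 * \<mu> - 2"
    have \<theta>: "0 \<le> \<theta>" "\<theta> \<le> 1" and \<mu>: "\<mu> = 1 + \<theta> / 2" using 1 assms by (simp_all add: \<theta>_def field_simps)
    have "exp (- 5 / 12 - \<mu> / 2) = exp ((1 - \<theta>) * (- real 11 / 12) + \<theta> * (- real 14 / 12))"
      by (simp add: \<mu> field_simps)
    also have "\<dots> \<le> (1 - \<theta>) * z ^ 11 + \<theta> * z ^ 14"
      using exp_chord_le[OF \<theta>] unfolding z_pow[symmetric] .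
    finally have chord: "exp (- 5 / 12 - \<mu> / 2) \<le> (1 - \<theta>) * z ^ 11 + \<theta> * z ^ 14" .
    have "\<mu>\<^sup>2 \<le> 1 + 5 / 4 * \<theta>"
      using \<theta> mult_left_mono[of \<theta> 1 \<theta>] by (simp add: \<mu> power2_eq_square field_simps)
    then have "z ^ 21 * (1 + (7 / 4 - (1 + 5 / 4 * \<theta>))) \<le> z ^ 21 * exp (7 / 4 - \<mu>\<^sup>2)"
      using exp_ge_add_one_self[of "7 / 4 - \<mu>\<^sup>2"] by (intro mult_left_mono) (auto simp: z_def)
    also have "\<dots> = exp (- \<mu>\<^sup>2)"
      using z_pow[of 21] by (simp add: exp_add[symmetric] flip: z_pow)
    finally have tangent: "z ^ 21 * (7 / 4 - 5 / 4 * \<theta>) \<le> exp (- \<mu>\<^sup>2)" by simp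
    have "0 < z ^ 6 - z ^ 12 + 7 / 4 * z ^ 21 - z ^ 11" "0 < z ^ 6 - z ^ 12 + 1 / 2 * z ^ 21 - z ^ 14"
      using z6 z12 z21 z11 z14 by linarith+
    then have "0 < (1 - \<theta>) * (z ^ 6 - z ^ 12 + 7 / 4 * z ^ 21 - z ^ 11) + \<theta> * (z ^ 6 - z ^ 12 + 1 / 2 * z ^ 21 - z ^ 14)"
      using \<theta> by (cases "\<theta> = 0") (auto intro!: add_nonneg_pos)
    also have "\<dots> = z ^ 6 - z ^ 12 + z ^ 21 * (7 / 4 - 5 / 4 * \<theta>) - ((1 - \<theta>) * z ^ 11 + \<theta> * z ^ 14)"
      by (simp add: field_simps)
    finally show ?thesis using chord tangent unfolding const by linarith
  next
    case 2
    define \<theta> where "\<theta> = 2 * \<mu> - 3"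
    have \<theta>: "0 \<le> \<theta>" "\<theta> \<le> 1" and \<mu>: "\<mu> = 3 / 2 + \<theta> / 2" using 2 by (simp_all add: \<theta>_def field_simps)
    have "exp (- 5 / 12 - \<mu> / 2) = exp ((1 - \<theta>) * (- real 14 / 12) + \<theta> * (- real 17 / 12))"
      by (simp add: \<mu> field_simps)
    also have "\<dots> \<le> (1 - \<theta>) * z ^ 14 + \<theta> * z ^ 17"
      using exp_chord_le[OF \<theta>] unfolding z_pow[symmetric] .
    finally have chord: "exp (- 5 / 12 - \<mu> / 2) \<le> (1 - \<theta>) * z ^ 14 + \<theta> * z ^ 17" .
    have "\<mu>\<^sup>2 \<le> 9 / 4 + 7 / 4 * \<theta>"
      using \<theta> mult_left_mono[of \<theta> 1 \<theta>] by (simp add: \<mu> power2_eq_square field_simps)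
    then have "z ^ 39 * (1 + (13 / 4 - (9 / 4 + 7 / 4 * \<theta>))) \<le> z ^ 39 * exp (13 / 4 - \<mu>\<^sup>2)"
      using exp_ge_add_one_self[of "13 / 4 - \<mu>\<^sup>2"] by (intro mult_left_mono) (auto simp: z_def)
    also have "\<dots> = exp (- \<mu>\<^sup>2)"
      using z_pow[of 39] by (simp add: exp_add[symmetric] flip: z_pow)
    finally have tangent: "z ^ 39 * (2 - 7 / 4 * \<theta>) \<le> exp (- \<mu>\<^sup>2)" by simp
    have "0 < z ^ 6 - z ^ 12 + 2 * z ^ 39 - z ^ 14" "0 < z ^ 6 - z ^ 12 + 1 / 4 * z ^ 39 - z ^ 17"
      using z6 z12 z39 z14 z17 by linarith+
    then have "0 < (1 - \<theta>) * (z ^ 6 - z ^ 12 + 2 * z ^ 39 - z ^ 14) + \<theta> * (z ^ 6 - z ^ 12 + 1 / 4 * z ^ 39 - z ^ 17)"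
      using \<theta> by (cases "\<theta> = 0") (auto intro!: add_nonneg_pos)
    also have "\<dots> = z ^ 6 - z ^ 12 + z ^ 39 * (2 - 7 / 4 * \<theta>) - ((1 - \<theta>) * z ^ 14 + \<theta> * z ^ 17)"
      by (simp add: field_simps)
    finally show ?thesis using chord tangent unfolding const by linarith
  next
    case 3
    have "exp (- 5 / 12 - \<mu> / 2) \<le> z ^ 17" using 3 by (simp flip: z_pow)
    moreover have "\<mu>\<^sup>2 \<le> (13 / 6)\<^sup>2" using 3 by (intro power_mono) auto
    then have "z ^ 57 \<le> exp (- \<mu>\<^sup>2)" by (simp add: power2_eq_square flip: z_pow)
    moreover have "z ^ 12 + z ^ 17 < z ^ 6 + z ^ 57"
      using z6 z12 z57 z17 by linarith
    ultimately show ?thesis unfolding const by linarith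
  next
    case 4
    have "exp (- 5 / 12 - \<mu> / 2) \<le> z ^ 18" using 4 by (simp flip: z_pow)
    moreover have "z ^ 12 + z ^ 18 < z ^ 6" using z6 z12 z18 by linarith
    ultimately show ?thesis unfolding const using exp_gt_zero[of "- \<mu>\<^sup>2"] by linarith
  qed
qed

section \<open>Asymptotics\<close>

lemma tv_dist_nonneg: "0 \<le> tv_dist \<mu> \<nu>"
  by (simp add: tv_dist_def infsum_nonneg)

text \<open>This is stronger than the bound on the limit inferior in two ways: the inequality holds from some
  \<open>n\<close> on, without a correction term, and for all starting states at once. The first is possible
  because both inequalities behind it, \<open>liminf (g n / f n) > r\<close> and \<open>exp_gap_inequality\<close>, are strict and
  absorb all vanishing terms.\<close>
lemma eventually_tv_at_walk_time_ge:
  fixes f g :: "nat \<Rightarrow> nat" and r c :: real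
  assumes g1: "\<And>n. n \<ge> 1 \<Longrightarrow> g n \<ge> 1"
    and gf: "\<And>n. n \<ge> 1 \<Longrightarrow> f n \<ge> g n"
    and f_small: "(\<lambda>n. real (f n) / real n) \<longlonglongrightarrow> 0"
    and f_top: "filterlim f at_top sequentially"
    and ratio: "liminf (\<lambda>n. ereal (real (g n) / real (f n))) > ereal r"
    and "r > 0"
  shows "\<forall>\<^sub>F n in sequentially. \<forall>x \<in> restricted_perms n (mat_of_bounds (bounds_fg f g n)).
    1 / exp 1 - exp (- r * exp c) \<le> tv_at_walk_time f g c n x"
proof (cases "r * exp c \<le> 1")
  case True
  then have "1 / exp 1 - exp (- r * exp c) \<le> 0" by (simp add: exp_minus[symmetric] inverse_eq_divide[symmetric])
  then show ?thesis
    unfolding tv_at_walk_time_def Let_def by (intro always_eventually allI ballI order_trans[OF _ tv_dist_nonneg])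
next
  case False
  define \<mu> where "\<mu> = sqrt r * exp (c / 2)"
  have \<mu>_sq: "\<mu>\<^sup>2 = r * exp c"
    using \<open>r > 0\<close> by (simp add: \<mu>_def power_mult_distrib exp_double[symmetric])
  have \<mu>: "\<mu> \<ge> 1"
    using False \<mu>_sq \<open>r > 0\<close> by (smt (verit) \<mu>_def exp_gt_zero mult_nonneg_nonneg power2_le_imp_le one_power2 real_sqrt_ge_zero)
  (* The room between r and r' compensates the factor w n, which tends to 1. *)
  obtain r' where r': "r < r'" "ereal r' < liminf (\<lambda>n. ereal (real (g n) / real (f n)))"
    using ereal_dense2[OF ratio] by auto
  have ev_ratio: "\<forall>\<^sub>F n in sequentially. r' < real (g n) / real (f n)"
    using less_LiminfD[OF r'(2)] by simp
  have f_real_top: "filterlim (\<lambda>n. real (f n)) at_top sequentially"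
    using filterlim_compose[OF filterlim_real_sequentially f_top] .
  have ev_small: "\<forall>\<^sub>F n in sequentially. real (f n) / real n < 1 / 4"
    using order_tendstoD(2)[OF f_small, of "1 / 4"] by simp

  let ?\<delta> = "\<lambda>n. exp (- 1 / (2 * (real (f n) - 1)))"
  let ?\<beta> = "exp (1 / 12 - \<mu> / 2)"
  let ?L = "\<lambda>n. ln (real (g n)) + ln (real (f n)) - c"
  let ?B = "\<lambda>y. exp (- 1 / 2) * (exp (- 1 / (2 * (y - 1))) - ?\<beta>) - 3 / 2 * (2 * ln y - c) / y"
  have lim_\<delta>: "?\<delta> \<longlonglongrightarrow> 1"
  proof -
    have "((\<lambda>y::real. exp (- 1 / (2 * (y - 1)))) \<longlongrightarrow> 1) at_top" by real_asymp
    from filterlim_compose[OF this f_real_top] show ?thesis .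
  qed
  have lim_B: "(\<lambda>n. ?B (real (f n))) \<longlonglongrightarrow> exp (- 1 / 2) * (1 - ?\<beta>)"
  proof -
    have "((\<lambda>y. exp (- 1 / (2 * (y - 1)))) \<longlongrightarrow> (1::real)) at_top" by real_asymp
    moreover have "((\<lambda>y. 3 / 2 * (2 * ln y - c) / y) \<longlongrightarrow> 0) at_top" by real_asymp
    ultimately have "(?B \<longlongrightarrow> exp (- 1 / 2) * (1 - ?\<beta>) - 0) at_top" by (intro tendsto_intros)
    from filterlim_compose[OF this f_real_top] show ?thesis by simp
  qed
  have "?\<beta> < 1" using \<mu> by simp
  then have ev_gap: "\<forall>\<^sub>F n in sequentially. ?\<beta> < ?\<delta> n" by (rule order_tendstoD(1)[OF lim_\<delta>])
  have "1 / exp 1 - exp (- r * exp c) < exp (- 1 / 2) * (1 - ?\<beta>)"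
  proof -
    have "exp (- 1 / 2) * ?\<beta> = exp (- 5 / 12 - \<mu> / 2)" by (simp add: exp_add[symmetric])
    moreover have "1 / exp 1 = exp (- 1 :: real)" by (simp add: exp_minus inverse_eq_divide)
    ultimately show ?thesis
      using exp_gap_inequality[OF \<mu>] unfolding \<mu>_sq right_diff_distrib by simp
  qed
  then have ev_B: "\<forall>\<^sub>F n in sequentially. 1 / exp 1 - exp (- r * exp c) < ?B (real (f n))"
    by (rule order_tendstoD(1)[OF lim_B])

  (* Lower bound for the factor by which the number of surviving agreements falls short of
    its approximation sqrt (g n / f n) * exp (c / 2). *)
  define w where "w = (\<lambda>n. (1 - 1 / (r' * real (f n))) * exp (- (2 * ln (real n) + \<bar>c\<bar>) / real n))"
  have "(\<lambda>n. sqrt r' * w n) \<longlonglongrightarrow> sqrt r' * (1 * 1)"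
    unfolding w_def
  proof (intro tendsto_intros)
    have "((\<lambda>y. 1 - 1 / (r' * y)) \<longlongrightarrow> 1) at_top" using r'(1) \<open>r > 0\<close> by real_asymp
    from filterlim_compose[OF this f_real_top] show "(\<lambda>n. 1 - 1 / (r' * real (f n))) \<longlonglongrightarrow> 1" .
    show "(\<lambda>n. exp (- (2 * ln (real n) + \<bar>c\<bar>) / real n)) \<longlonglongrightarrow> 1" by real_asymp
  qed
  then have ev_w: "\<forall>\<^sub>F n in sequentially. sqrt r < sqrt r' * w n"
    by (rule order_tendstoD) (use r'(1) in simp)

  have "\<forall>\<^sub>F n in sequentially. \<bar>c\<bar> \<le> ln (real (f n))"
    using filterlim_compose[OF ln_at_top f_real_top] by (simp add: filterlim_at_top)
  moreover have "\<forall>\<^sub>F n in sequentially. 2 \<le> f n" using f_top by (simp add: filterlim_at_top)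
  ultimately show ?thesis
    using ev_ratio ev_small ev_gap ev_B ev_w eventually_ge_at_top[of 1]
  proof eventually_elim
    case (elim n)
    have n: "real n > 0" "4 * f n \<le> n" using elim by (auto simp: field_simps)
    have fg: "1 \<le> g n" "g n \<le> f n" "f n < n" using g1 gf elim n by auto
    interpret two_block_walk n "f n" "g n" by unfold_locales (use fg in auto)
    have M: "mat_of_bounds (bounds_fg f g n) = M" by (simp add: M_def bounds_fg_def)
    let ?t = "walk_time f g c n"
    have logs: "0 \<le> ln (real (g n))" "ln (real (g n)) \<le> ln (real (f n))" "ln (real (f n)) \<le> ln (real n)"
      using fg n by auto
    have L: "0 \<le> ?L n" "?L n \<le> 2 * ln (real (f n)) - c" "?L n \<le> 2 * ln (real n) + \<bar>c\<bar>"
      using logs elim(1) by linarith+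
    have t: "real ?t \<le> N / (4 * real (f n)) * ?L n"
    proof -
      have "?t = nat \<lfloor>N / (4 * real (f n)) * ?L n\<rfloor>"
        unfolding walk_time_def Let_def bounds_fg_def N_eq_graph_degree by (simp add: algebra_simps diff_divide_distrib)
      moreover have "0 \<le> N / (4 * real (f n)) * ?L n" using L(1) N_pos by simp
      ultimately show ?thesis by (simp add: of_nat_floor)
    qed
    have \<mu>_le: "\<mu> \<le> (real (g n) - 1) * exp (- ?L n / 2) * exp (- ?L n / real n)"
    proof -
      have fgpos: "0 < real (f n)" "0 < real (g n)" using fg by auto
      have "exp (- ?L n / 2) = exp (c / 2) / (sqrt (real (g n)) * sqrt (real (f n)))"
      proof -
        have "exp (ln y / 2) = sqrt y" if "y > 0" for y :: real
          using that by (simp add: ln_sqrt[symmetric])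
        then have "exp (c / 2 - ln (real (g n)) / 2 - ln (real (f n)) / 2) = exp (c / 2) / sqrt (real (g n)) / sqrt (real (f n))"
          using fgpos by (simp add: exp_diff)
        moreover have "- ?L n / 2 = c / 2 - ln (real (g n)) / 2 - ln (real (f n)) / 2"
          by (simp add: diff_divide_distrib add_divide_distrib)
        ultimately show ?thesis by (simp only: divide_divide_eq_left)
      qed
      note exp_L = this
      define p where "p = sqrt (real (g n))"
      have p: "p > 0" "real (g n) - 1 = p * p * (1 - 1 / real (g n))"
        using fgpos by (simp_all add: p_def field_simps)
      have eq: "(real (g n) - 1) * exp (- ?L n / 2) =
        sqrt (real (g n) / real (f n)) * (1 - 1 / real (g n)) * exp (c / 2)"
        unfolding exp_L real_sqrt_divide p_def[symmetric] unfolding p(2) using p(1) by simp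
      have ratio_f: "r' * real (f n) \<le> real (g n)" using elim fgpos by (simp add: field_simps)
      have r'f: "0 < r' * real (f n)" using r'(1) \<open>r > 0\<close> fgpos by simp
      have "sqrt r * exp (c / 2) \<le> sqrt r' * w n * exp (c / 2)"
        using elim by (intro mult_right_mono) auto
      also have "\<dots> \<le> (sqrt r' * (1 - 1 / real (g n)) * exp (- ?L n / real n)) * exp (c / 2)"
      proof -
        have "1 / real (g n) \<le> 1 / (r' * real (f n))" using ratio_f r'f by (intro divide_left_mono) auto
        moreover have "- (2 * ln (real n) + \<bar>c\<bar>) / real n \<le> - ?L n / real n"
          using L(3) n by (intro divide_right_mono) auto
        ultimately have "w n \<le> (1 - 1 / real (g n)) * exp (- ?L n / real n)"
          unfolding w_def using fg by (intro mult_mono) auto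
        then show ?thesis using r'(1) \<open>r > 0\<close> by (simp add: mult.assoc mult_left_mono)
      qed
      also have "\<dots> \<le> (sqrt (real (g n) / real (f n)) * (1 - 1 / real (g n)) * exp (- ?L n / real n)) * exp (c / 2)"
        using elim fg by (intro mult_right_mono) auto
      finally show ?thesis unfolding eq \<mu>_def by (simp add: mult_ac)
    qed
    have "?B (real (f n)) \<le> exp (- 1 / 2) * (?\<delta> n - ?\<beta>) - 3 / 2 * ?L n / real (f n)"
      using L(2) by (intro diff_left_mono divide_right_mono) auto
    then show ?case
      using tv_dist_walk_ge_of_time_le[OF _ _ _ n(2) t L(1) \<mu>_le] elim fg
      unfolding tv_at_walk_time_def Let_def M S_def[symmetric] by force
  qed
qed

theorem theorem2p13:
  fixes f g :: "nat \<Rightarrow> nat" and r :: real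
  assumes "\<And>n. n \<ge> 1 \<Longrightarrow> f n \<ge> 1"
    and "\<And>n. n \<ge> 1 \<Longrightarrow> g n \<ge> 1"
    and "\<And>n. n \<ge> 1 \<Longrightarrow> f n \<ge> g n"
    and "(\<lambda>n. real (f n) / real n) \<longlonglongrightarrow> 0"
    and "filterlim f at_top sequentially"
    and "liminf (\<lambda>n. ereal (real (g n) / real (f n))) > ereal r"
    and "r > 0"
  shows "(\<forall>c::real. \<forall>x :: nat \<Rightarrow> nat \<Rightarrow> nat.
            (\<forall>n\<ge>1. x n \<in> restricted_perms n (mat_of_bounds (bounds_fg f g n))) \<longrightarrow>
            liminf (\<lambda>n. ereal (tv_at_walk_time f g c n (x n)))
              \<ge> ereal (1 / exp 1 - exp (- r * exp c)))
       \<and> (\<forall>\<epsilon>::real. \<epsilon> < 1 / exp 1 \<longrightarrow>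
            (\<exists>C::real. \<forall>c\<ge>C. \<forall>\<^sub>F n in sequentially.
               \<forall>x \<in> restricted_perms n (mat_of_bounds (bounds_fg f g n)).
                 tv_at_walk_time f g c n x > \<epsilon>))"
proof (intro conjI allI impI)
  have bound: "\<forall>\<^sub>F n in sequentially. \<forall>x \<in> restricted_perms n (mat_of_bounds (bounds_fg f g n)).
      1 / exp 1 - exp (- r * exp c) \<le> tv_at_walk_time f g c n x" for c
    by (rule eventually_tv_at_walk_time_ge) (use assms in auto)
  {
    fix c :: real and x :: "nat \<Rightarrow> nat \<Rightarrow> nat"
    assume x: "\<forall>n\<ge>1. x n \<in> restricted_perms n (mat_of_bounds (bounds_fg f g n))"
    show "liminf (\<lambda>n. ereal (tv_at_walk_time f g c n (x n))) \<ge> ereal (1 / exp 1 - exp (- r * exp c))"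
    proof (rule Liminf_bounded)
      show "\<forall>\<^sub>F n in sequentially.
          ereal (1 / exp 1 - exp (- r * exp c)) \<le> ereal (tv_at_walk_time f g c n (x n))"
        using bound[of c] eventually_ge_at_top[of 1] by eventually_elim (use x in auto)
    qed
  next
    fix \<epsilon> :: real assume \<epsilon>: "\<epsilon> < 1 / exp 1"
    have "((\<lambda>c. 1 / exp 1 - exp (- r * exp c)) \<longlongrightarrow> 1 / exp 1) at_top"
      using \<open>r > 0\<close> by real_asymp
    then have "\<forall>\<^sub>F c in at_top. \<epsilon> < 1 / exp 1 - exp (- r * exp c)"
      using \<epsilon> by (rule order_tendstoD)
    then obtain C where C: "\<And>c. c \<ge> C \<Longrightarrow> \<epsilon> < 1 / exp 1 - exp (- r * exp c)"
      unfolding eventually_at_top_linorder by blast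
    have "\<forall>\<^sub>F n in sequentially. \<forall>x \<in> restricted_perms n (mat_of_bounds (bounds_fg f g n)).
        tv_at_walk_time f g c n x > \<epsilon>" if "c \<ge> C" for c
      using bound[of c] by eventually_elim (use C[OF that] in force)
    then show "\<exists>C::real. \<forall>c\<ge>C. \<forall>\<^sub>F n in sequentially.
               \<forall>x \<in> restricted_perms n (mat_of_bounds (bounds_fg f g n)).
                 tv_at_walk_time f g c n x > \<epsilon>" by blast
  }
qed

end
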